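(* Let $b\ge 0$ and $c>0$ be real numbers, let $p$ be a positive integer, let $s>3/2$ and $T>0$, and assume that $u\in C^0([0,T),H^s(\mathbb{S}))$ is a non-negative or non-positive solution of $$u_t-u_{txx}+(b+c)u^pu_{x}=bu^{p-1}u_{x}u_{xx}+cu^pu_{xxx}.$$ Suppose that either $p=1$ and $b\in[0,3c]$, or $b=pc$. If there exists a piece of cylinder $\mathcal{S}=(t_0,t_1)\times(x_0,x_1)\subseteq[0,T)\times\mathbb{S}$, with $t_0<t_1$ and $x_0<x_1$, such that $u\big|_{\mathcal{S}}\equiv0$, then $u\equiv0$ on $[0,T)\times\mathbb{S}$.
   Context: $\mathbb{S}$ is the circle, identified with $[0,1)$ (functions on $\mathbb{S}$ are $1$-periodic functions on $\mathbb{R}$); $H^s(\mathbb{S})$ is the Sobolev space of order $s$ on the circle. Solutions are assumed to be at least $C^1$ in $t$, with $u\in C^1([0,T),H^{s-1}(\mathbb{S}))$; for low $s$ the equation is understood in the equivalent non-local form $$u_t+cu^pu_x=-\partial_x\Lambda^{-2}\Big(\tfrac{3pc-b}{2}u^{p-1}u_x^2+\tfrac{b}{p+1}u^{p+1}\Big)-\tfrac{(p-1)(b-pc)}{2}\Lambda^{-2}\big(u^{p-2}u_x^3\big),$$ where $\Lambda^{-2}=(1-\partial_x^2)^{-1}$ on the circle (the last term is absent when $p=1$ or $b=pc$). Local well-posedness in $H^s(\mathbb{S})$, $s>3/2$ (existence, uniqueness and continuous dependence on the initial data in $C^0([0,T),H^s(\mathbb{S}))\cap C^1([0,T),H^{s-1}(\mathbb{S}))$)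 is known. *)

theory Defs
  imports "HOL-Analysis.Analysis"
begin

text \<open>
  Functions on the circle are 1-periodic functions on the real line.
\<close>

definition periodic1 :: "(real \<Rightarrow> real) \<Rightarrow> bool" where
  "periodic1 f \<longleftrightarrow> (\<forall>x. f (x + 1) = f x)"

definition fourier_coeff :: "(real \<Rightarrow> real) \<Rightarrow> int \<Rightarrow> complex" where
  "fourier_coeff f k =
     (LINT x:{0..<1}|lebesgue. complex_of_real (f x) * cis (- (2 * pi * of_int k * x)))"

text \<open>
  The Sobolev space of order \<open>r\<close>, meant for \<open>r \<ge> 0\<close>, where its elements are (classes of)
  square integrable functions. The norm is \<open>(\<Sum>k. (1 + (2 \<pi> k)\<^sup>2)\<^sup>r |f^(k)|\<^sup>2)\<^sup>1\<^sup>/\<^sup>2\<close>; it vanishes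
  on functions that are zero almost everywhere, so \<open>sobolev r\<close> is a space of representatives.
\<close>

definition sobolev_term :: "real \<Rightarrow> (real \<Rightarrow> real) \<Rightarrow> int \<Rightarrow> real" where
  "sobolev_term r f k = (1 + (2 * pi * of_int k)\<^sup>2) powr r * (cmod (fourier_coeff f k))\<^sup>2"

definition sobolev :: "real \<Rightarrow> (real \<Rightarrow> real) set" where
  "sobolev r = {f. periodic1 f \<and> f \<in> borel_measurable lebesgue \<and>
     set_integrable lebesgue {0..<1} (\<lambda>x. (f x)\<^sup>2) \<and>
     sobolev_term r f summable_on UNIV}"

definition sobolev_norm :: "real \<Rightarrow> (real \<Rightarrow> real) \<Rightarrow> real" where
  "sobolev_norm r f = sqrt (\<Sum>\<^sub>\<infinity>k. sobolev_term r f k)"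

text \<open>
  \<open>u t x\<close> is the value at time \<open>t\<close> and position \<open>x\<close>. The first predicate is
  \<open>u \<in> C\<^sup>0(I, H\<^sup>r)\<close>; the second one says that \<open>u \<in> C\<^sup>1(I, H\<^sup>r)\<close> with time derivative \<open>v\<close>,
  where difference quotients converge in the norm of \<open>H\<^sup>r\<close> (one-sided at an end point
  belonging to \<open>I\<close>).
\<close>

definition sobolev_C0 :: "real \<Rightarrow> real set \<Rightarrow> (real \<Rightarrow> real \<Rightarrow> real) \<Rightarrow> bool" where
  "sobolev_C0 r I u \<longleftrightarrow> (\<forall>t\<in>I. u t \<in> sobolev r) \<and>
     (\<forall>t\<in>I. ((\<lambda>\<tau>. sobolev_norm r (\<lambda>x. u \<tau> x - u t x)) \<longlongrightarrow> 0) (at t within I))"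

definition sobolev_C1 ::
    "real \<Rightarrow> real set \<Rightarrow> (real \<Rightarrow> real \<Rightarrow> real) \<Rightarrow> (real \<Rightarrow> real \<Rightarrow> real) \<Rightarrow> bool" where
  "sobolev_C1 r I u v \<longleftrightarrow> (\<forall>t\<in>I. u t \<in> sobolev r) \<and> sobolev_C0 r I v \<and>
     (\<forall>t\<in>I. ((\<lambda>\<tau>. sobolev_norm r (\<lambda>x. (u \<tau> x - u t x) / (\<tau> - t) - v t x)) \<longlongrightarrow> 0)
        (at t within I))"

text \<open>
  \<open>inv_helmholtz\<close> is \<open>\<Lambda>\<^sup>-\<^sup>2 = (1 - \<partial>\<^sub>x\<^sup>2)\<^sup>-\<^sup>1\<close> on the circle: for a continuous 1-periodic \<open>f\<close> there
  is exactly one 1-periodic solution \<open>w\<close> of \<open>w - w'' = f\<close>. It is applied below to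
  continuous functions only.
\<close>

definition inv_helmholtz :: "(real \<Rightarrow> real) \<Rightarrow> real \<Rightarrow> real" where
  "inv_helmholtz f = (THE w. periodic1 w \<and>
     (\<exists>w' w''. \<forall>x. (w has_real_derivative w' x) (at x) \<and>
        (w' has_real_derivative w'' x) (at x) \<and> w x - w'' x = f x))"

text \<open>
  Solutions of
  \<open>u\<^sub>t - u\<^sub>t\<^sub>x\<^sub>x + (b + c) u\<^sup>p u\<^sub>x = b u\<^sup>p\<^sup>-\<^sup>1 u\<^sub>x u\<^sub>x\<^sub>x + c u\<^sup>p u\<^sub>x\<^sub>x\<^sub>x\<close>
  in \<open>C\<^sup>0([0,T), H\<^sup>s) \<inter> C\<^sup>1([0,T), H\<^sup>s\<^sup>-\<^sup>1)\<close> with \<open>s > 3/2\<close>, understood in the non-local form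
  obtained by inverting \<open>1 - \<partial>\<^sub>x\<^sup>2\<close>. Since \<open>H\<^sup>s\<close> embeds into \<open>C\<^sup>1\<close>, each \<open>u t\<close> is taken to be the
  continuous representative of its class, which makes \<open>u\<^sub>x\<close> a classical derivative;
  \<open>v = u\<^sub>t\<close> is only determined almost everywhere. For \<open>p = 1\<close> the truncated exponent \<open>p - 2\<close>
  is harmless because the coefficient of the last term vanishes.
\<close>

definition nonlocal_solution ::
    "real \<Rightarrow> real \<Rightarrow> nat \<Rightarrow> real \<Rightarrow> real \<Rightarrow> (real \<Rightarrow> real \<Rightarrow> real) \<Rightarrow> bool" where
  "nonlocal_solution b c p s T u \<longleftrightarrow>
     sobolev_C0 s {0..<T} u \<and>
     (\<forall>t\<in>{0..<T}. continuous_on UNIV (u t)) \<and>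
     (\<exists>v. sobolev_C1 (s - 1) {0..<T} u v \<and>
       (\<forall>t\<in>{0..<T}. AE x in lebesgue.
          v t x + c * u t x ^ p * deriv (u t) x =
          - deriv (inv_helmholtz (\<lambda>y. (3 * real p * c - b) / 2 * u t y ^ (p - 1) * (deriv (u t) y)\<^sup>2
                                      + b / (real p + 1) * u t y ^ (p + 1))) x
          - (real p - 1) * (b - real p * c) / 2
              * inv_helmholtz (\<lambda>y. u t y ^ (p - 2) * (deriv (u t) y) ^ 3) x))"

end

theory Submission
  imports Defs
begin

text \<open>
  Let \<open>F(t, \<cdot>)\<close> be the function whose image under \<open>- \<partial>\<^sub>x \<Lambda>\<^sup>-\<^sup>2\<close> is the forcing term, and
  \<open>w = \<Lambda>\<^sup>-\<^sup>2 F\<close>. Under the hypotheses on \<open>b\<close>, \<open>c\<close>, \<open>p\<close> the cubic term is absent and \<open>F\<close> has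
  constant sign. At a time \<open>t\<close> in \<open>(t0, t1)\<close> the equation reduces to \<open>w\<^sub>x = 0\<close> on \<open>(x0, x1)\<close>, and
  \<open>w - w\<^sub>x\<^sub>x = F = 0\<close> there, so that \<open>w = w\<^sub>x = 0\<close> at some point. Integrating
  \<open>(e\<^sup>-\<^sup>x (w + w\<^sub>x))\<^sub>x = - e\<^sup>-\<^sup>x F\<close> over a period gives \<open>F(t, \<cdot>) = 0\<close> and then \<open>u(t, \<cdot>) = 0\<close>. Without
  the cubic term the equation is in divergence form, so the mean of \<open>u\<close> is conserved; it vanishes at time \<open>t\<close>,
  hence always, and \<open>u\<close> has constant sign.

  The time derivative is only given in \<open>H\<^sup>s\<^sup>-\<^sup>1\<close> and almost everywhere. It has the continuous
  representative dictated by the equation, and \<open>s - 1 > 1/2\<close> turns convergence of the difference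
  quotients in \<open>H\<^sup>s\<^sup>-\<^sup>1\<close> into uniform convergence.
\<close>

section \<open>Fourier coefficients and Sobolev spaces on the circle\<close>

lemma periodic1_int:
  assumes "periodic1 f"
  shows "f (x + of_int k) = f x"
proof -
  have nat: "f (y + real n) = f y" for y n
  proof (induction n)
    case (Suc n)
    have "f (y + real (Suc n)) = f ((y + real n) + 1)" by (simp add: algebra_simps)
    then show ?case using assms Suc by (simp add: periodic1_def)
  qed simp
  show ?thesis
  proof (cases "k \<ge> 0")
    case True
    then show ?thesis using nat[of x "nat k"] by simp
  next
    case False
    then show ?thesis using nat[of "x + of_int k" "nat (- k)"] by simp
  qed
qed

lemma periodic1_frac: "periodic1 f \<Longrightarrow> f (frac x) = f x"
  using periodic1_int[of f x "- \<lfloor>x\<rfloor>"] by (simp add: frac_def)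

lemma cis_period: "cis (2 * pi * of_int k * (x + 1)) = cis (2 * pi * of_int k * x)"
proof -
  have "cis (2 * pi * of_int k * (x + 1)) = cis (2 * pi * of_int k * x) * cis (2 * pi * of_int k)"
    by (simp add: cis_mult algebra_simps)
  then show ?thesis by (simp add: cis_multiple_2pi)
qed

lemma fourier_integrand_measurable:
  "(\<lambda>x. cis (- (2 * pi * of_int k * x))) \<in> borel_measurable lebesgue"
  by (intro measurable_completion) (simp add: borel_measurable_continuous_onI continuous_intros)

lemma fourier_integrand_integrable:
  assumes "set_integrable lebesgue {0..<1} f"
  shows "set_integrable lebesgue {0..<1} (\<lambda>x. complex_of_real (f x) * cis (- (2 * pi * of_int k * x)))"
proof -
  note int = assms[unfolded set_integrable_def]
  note [measurable] = borel_measurable_integrable[OF int] fourier_integrand_measurable[of k]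
  have "(\<lambda>x. complex_of_real (indicator {0..<1} x *\<^sub>R f x) * cis (- (2 * pi * of_int k * x)))
      \<in> borel_measurable lebesgue"
    by measurable
  then have "integrable lebesgue
      (\<lambda>x. complex_of_real (indicator {0..<1} x *\<^sub>R f x) * cis (- (2 * pi * of_int k * x)))"
    by (rule Bochner_Integration.integrable_bound[OF int]) (simp add: norm_mult)
  moreover have "(\<lambda>x. complex_of_real (indicator {0..<1} x *\<^sub>R f x) * cis (- (2 * pi * of_int k * x))) =
     (\<lambda>x. indicator {0..<1} x *\<^sub>R (complex_of_real (f x) * cis (- (2 * pi * of_int k * x))))"
    by (auto simp: indicator_def)
  ultimately show ?thesis unfolding set_integrable_def by simp
qed

lemma fourier_coeff_lincomb:
  assumes "set_integrable lebesgue {0..<1} f" "set_integrable lebesgue {0..<1} g"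
  shows "fourier_coeff (\<lambda>x. a * f x + b * g x) k = a * fourier_coeff f k + b * fourier_coeff g k"
proof -
  let ?e = "\<lambda>x. cis (- (2 * pi * of_int k * x))"
  have "fourier_coeff (\<lambda>x. a * f x + b * g x) k =
      (LINT x:{0..<1}|lebesgue. of_real a * (complex_of_real (f x) * ?e x)
        + of_real b * (complex_of_real (g x) * ?e x))"
    unfolding fourier_coeff_def by (simp add: algebra_simps)
  also have "\<dots> = (LINT x:{0..<1}|lebesgue. of_real a * (complex_of_real (f x) * ?e x))
        + (LINT x:{0..<1}|lebesgue. of_real b * (complex_of_real (g x) * ?e x))"
    using assms by (intro set_integral_add set_integrable_mult_right fourier_integrand_integrable)
  finally show ?thesis unfolding fourier_coeff_def by (simp only: set_integral_mult_right)
qed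

lemma fourier_coeff_cong_AE:
  assumes "f \<in> borel_measurable lebesgue" "g \<in> borel_measurable lebesgue"
    and "AE x in lebesgue. f x = g x"
  shows "fourier_coeff f = fourier_coeff g"
proof
  fix k
  note [measurable] = assms(1,2) fourier_integrand_measurable[of k]
  show "fourier_coeff f k = fourier_coeff g k"
    unfolding fourier_coeff_def
    by (rule set_lebesgue_integral_cong_AE) (use assms(3) in auto)
qed

lemma set_integrable_period:
  fixes f :: "real \<Rightarrow> 'a::euclidean_space"
  assumes "continuous_on UNIV f"
  shows "set_integrable lebesgue {0..<1} f"
proof -
  have "f absolutely_integrable_on {0..1}"
    using assms continuous_on_subset by (intro absolutely_integrable_continuous_real) blast
  then show ?thesis by (rule set_integrable_subset) auto
qed

lemma set_integral_period:
  fixes f :: "real \<Rightarrow> 'a::euclidean_space"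
  assumes "continuous_on UNIV f"
  shows "(LINT x:{0..<1}|lebesgue. f x) = integral {0..1} f"
proof -
  have "(LINT x:{0..<1}|lebesgue. f x) = integral {0..<1} f"
    using assms by (intro set_lebesgue_integral_eq_integral set_integrable_period)
  also have "\<dots> = integral {0..1} f"
    by (rule integral_subset_negligible) (auto intro: negligible_subset[of "{1}"])
  finally show ?thesis .
qed

lemma fourier_coeff_continuous:
  assumes "continuous_on UNIV f"
  shows "fourier_coeff f k = integral {0..1} (\<lambda>x. complex_of_real (f x) * cis (- (2 * pi * of_int k * x)))"
  unfolding fourier_coeff_def
  by (intro set_integral_period continuous_intros assms)

text \<open>A period has finite measure, so \<open>1 + (f x)\<^sup>2\<close> is integrable, and it
  dominates \<open>\<bar>f x\<bar>\<close>. The Fourier coefficients of a square integrable function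
  are therefore genuine integrals.\<close>

lemma set_integrable_of_square:
  fixes f :: "real \<Rightarrow> real"
  assumes "f \<in> borel_measurable lebesgue" "set_integrable lebesgue {0..<1} (\<lambda>x. (f x)\<^sup>2)"
  shows "set_integrable lebesgue {0..<1} f"
proof -
  have "set_integrable lebesgue {0..<1} (\<lambda>x. 1 + (f x)\<^sup>2)"
    by (rule set_integral_add(1)[OF set_integrable_period assms(2)]) simp
  then show ?thesis
  proof (rule set_integrable_bound)
    show "set_borel_measurable lebesgue {0..<1} f"
      using assms(1) unfolding set_borel_measurable_def
      by (intro borel_measurable_scaleR borel_measurable_indicator) auto
    have "\<bar>y\<bar> \<le> 1 + y\<^sup>2" for y :: real
    proof -
      have "(2 * \<bar>y\<bar> - 1)\<^sup>2 \<ge> 0" by simp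
      then show ?thesis by (simp add: power2_eq_square algebra_simps)
    qed
    then show "AE x in lebesgue. x \<in> {0..<1} \<longrightarrow> norm (f x) \<le> norm (1 + (f x)\<^sup>2)"
      by (auto simp: abs_of_nonneg)
  qed
qed

lemma sobolev_set_integrable: "f \<in> sobolev r \<Longrightarrow> set_integrable lebesgue {0..<1} f"
  by (auto simp: sobolev_def intro: set_integrable_of_square)

lemma sobolev_term_nonneg: "sobolev_term r f k \<ge> 0"
  by (simp add: sobolev_term_def)

text \<open>The inequality (y + z)^2 \<le> 2 y^2 + 2 z^2 is applied twice: pointwise in
  \<open>x\<close> for square integrability, and to each Fourier coefficient for the weighted
  sum.\<close>

lemma sobolev_lincomb:
  assumes f: "f \<in> sobolev r" and g: "g \<in> sobolev r"
  shows "(\<lambda>x. a * f x + b * g x) \<in> sobolev r"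
proof -
  let ?h = "\<lambda>x. a * f x + b * g x"
  have sq: "(a * y + b * z)\<^sup>2 \<le> 2 * a\<^sup>2 * y\<^sup>2 + 2 * b\<^sup>2 * z\<^sup>2" for y z :: real
  proof -
    have "(a * y - b * z)\<^sup>2 \<ge> 0" by simp
    then show ?thesis by (simp add: power2_eq_square algebra_simps)
  qed
  have "periodic1 ?h" using f g by (simp add: sobolev_def periodic1_def)
  moreover have meas [measurable]: "f \<in> borel_measurable lebesgue" "g \<in> borel_measurable lebesgue"
    using f g by (auto simp: sobolev_def)
  have "?h \<in> borel_measurable lebesgue" by measurable
  moreover have "set_integrable lebesgue {0..<1} (\<lambda>x. (?h x)\<^sup>2)"
  proof (rule set_integrable_bound)
    show "set_integrable lebesgue {0..<1} (\<lambda>x. 2 * a\<^sup>2 * (f x)\<^sup>2 + 2 * b\<^sup>2 * (g x)\<^sup>2)"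
      using f g by (intro set_integral_add(1) set_integrable_mult_right) (simp_all add: sobolev_def)
    have "(\<lambda>x. (?h x)\<^sup>2) \<in> borel_measurable lebesgue" by measurable
    then show "set_borel_measurable lebesgue {0..<1} (\<lambda>x. (?h x)\<^sup>2)"
      unfolding set_borel_measurable_def by (intro borel_measurable_scaleR borel_measurable_indicator) auto
    show "AE x in lebesgue. x \<in> {0..<1} \<longrightarrow>
        norm ((?h x)\<^sup>2) \<le> norm (2 * a\<^sup>2 * (f x)\<^sup>2 + 2 * b\<^sup>2 * (g x)\<^sup>2)"
    proof (rule AE_I2, rule impI)
      fix x
      have "0 \<le> 2 * a\<^sup>2 * (f x)\<^sup>2 + 2 * b\<^sup>2 * (g x)\<^sup>2" by simp
      then show "norm ((?h x)\<^sup>2) \<le> norm (2 * a\<^sup>2 * (f x)\<^sup>2 + 2 * b\<^sup>2 * (g x)\<^sup>2)"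
        using sq[of "f x" "g x"] by simp
    qed
  qed
  moreover have "sobolev_term r ?h summable_on UNIV"
  proof (rule summable_on_comparison_test)
    show "(\<lambda>k. 2 * a\<^sup>2 * sobolev_term r f k + 2 * b\<^sup>2 * sobolev_term r g k) summable_on UNIV"
      using f g by (intro summable_on_add summable_on_cmult_right) (simp_all add: sobolev_def)
    fix k
    have "cmod (fourier_coeff ?h k) \<le> \<bar>a\<bar> * cmod (fourier_coeff f k) + \<bar>b\<bar> * cmod (fourier_coeff g k)"
      using fourier_coeff_lincomb[OF sobolev_set_integrable[OF f] sobolev_set_integrable[OF g], of a b k]
        norm_triangle_ineq[of "a * fourier_coeff f k" "b * fourier_coeff g k"]
      by (simp add: norm_mult)
    then have "(cmod (fourier_coeff ?h k))\<^sup>2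
        \<le> (\<bar>a\<bar> * cmod (fourier_coeff f k) + \<bar>b\<bar> * cmod (fourier_coeff g k))\<^sup>2"
      by (intro power_mono) auto
    also have "\<dots> \<le> 2 * a\<^sup>2 * (cmod (fourier_coeff f k))\<^sup>2 + 2 * b\<^sup>2 * (cmod (fourier_coeff g k))\<^sup>2"
      using sum_squares_bound [of "\<bar>a\<bar> * cmod (fourier_coeff f k)" "\<bar>b\<bar> * cmod (fourier_coeff g k)"]
      by (simp add: power2_sum power_mult_distrib)
    finally have "(1 + (2 * pi * of_int k)\<^sup>2) powr r * (cmod (fourier_coeff ?h k))\<^sup>2 \<le>
        (1 + (2 * pi * of_int k)\<^sup>2) powr r *
        (2 * a\<^sup>2 * (cmod (fourier_coeff f k))\<^sup>2 + 2 * b\<^sup>2 * (cmod (fourier_coeff g k))\<^sup>2)"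
      by (rule mult_left_mono) simp
    then show "sobolev_term r ?h k \<le> 2 * a\<^sup>2 * sobolev_term r f k + 2 * b\<^sup>2 * sobolev_term r g k"
      unfolding sobolev_term_def distrib_left by (simp only: mult_ac)
  qed (rule sobolev_term_nonneg)
  ultimately show ?thesis by (simp add: sobolev_def)
qed

section \<open>Uniqueness of Fourier coefficients\<close>

text \<open>Complex coefficients are allowed so that sines and cosines are sums of two monomials.
  The inductive form lets closure under products and orthogonality be proved on monomials and
  extended by additivity.\<close>

inductive trig_poly :: "(real \<Rightarrow> complex) \<Rightarrow> bool" where
  trig_poly_mono: "trig_poly (\<lambda>x. a * cis (2 * pi * of_int k * x))"
| trig_poly_add: "trig_poly f \<Longrightarrow> trig_poly g \<Longrightarrow> trig_poly (\<lambda>x. f x + g x)"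

lemma trig_poly_mult:
  assumes "trig_poly f" "trig_poly g"
  shows "trig_poly (\<lambda>x. f x * g x)"
  using assms(1)
proof induction
  case (trig_poly_mono a k)
  show ?case
    using assms(2)
  proof induction
    case (trig_poly_mono b l)
    have "(\<lambda>x. a * cis (2 * pi * of_int k * x) * (b * cis (2 * pi * of_int l * x))) =
        (\<lambda>x. a * b * cis (2 * pi * of_int (k + l) * x))"
      by (simp add: fun_eq_iff cis_mult [symmetric] algebra_simps)
    then show ?case using trig_poly.trig_poly_mono[of "a * b" "k + l"] by simp
  next
    case (trig_poly_add f g)
    then show ?case using trig_poly.trig_poly_add by (simp add: distrib_left)
  qed
next
  case (trig_poly_add f1 f2)
  then show ?case using trig_poly.trig_poly_add by (simp add: distrib_right)
qed

lemma trig_poly_of_real_polynomial: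
  assumes "real_polynomial_function (g :: complex \<Rightarrow> real)"
  shows "trig_poly (\<lambda>x. of_real (g (cis (2 * pi * x))))"
  using assms
proof induction
  case (linear f)
  interpret bounded_linear f by fact
  have f: "f z = Re z * f 1 + Im z * f \<i>" for z
  proof -
    have "z = Re z *\<^sub>R 1 + Im z *\<^sub>R \<i>" by (simp add: complex_eq_iff)
    then have "f z = f (Re z *\<^sub>R 1 + Im z *\<^sub>R \<i>)" by simp
    also have "\<dots> = Re z * f 1 + Im z * f \<i>" by (simp only: add scaleR real_scaleR_def)
    finally show ?thesis .
  qed
  \<comment> \<open>Euler's formulas for cosine and sine, applied to
    \<open>cos * f 1 + sin * f \<i>\<close>, give these two coefficients.\<close>
  have "of_real (f (cis (2 * pi * x))) =
      (f 1 - \<i> * f \<i>) / 2 * cis (2 * pi * of_int 1 * x) + (f 1 + \<i> * f \<i>) / 2 * cis (2 * pi * of_int (- 1) * x)" for x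
    by (subst f) (simp add: complex_eq_iff field_simps)
  then show ?case
    by (simp only:) (intro trig_poly.intros)
next
  case (const c)
  show ?case using trig_poly_mono[of "of_real c" 0] by simp
next
  case (add f g)
  then show ?case by (simp add: trig_poly_add)
next
  case (mult f g)
  then show ?case by (simp add: trig_poly_mult)
qed

text \<open>The function is transported to the unit circle of the complex plane. Stone-Weierstrass
  gives a real polynomial in the two coordinates there, and its pullback along
  \<open>cis (2 * pi * x)\<close> is a trigonometric polynomial.\<close>

lemma trig_poly_approx:
  assumes "continuous_on UNIV f" "periodic1 f" "e > 0"
  obtains P where "trig_poly (\<lambda>x. complex_of_real (P x))" "\<And>x. \<bar>f x - P x\<bar> < e"
    "continuous_on UNIV P"
proof -
  \<comment> \<open>Two arguments of the same point differ by a multiple of 2 pi, so by periodicity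
    \<open>g\<close> does not depend on the branch of the argument.\<close>
  define g where "g z = f (Arg2pi z / (2 * pi))" for z
  have cis: "f (a / (2 * pi)) = f (b / (2 * pi))" if "cis a = cis b" for a b
  proof -
    from that have "sin a = sin b \<and> cos a = cos b" by (simp add: complex_eq_iff)
    then obtain n :: int where "a = b + 2 * pi * n" unfolding sin_cos_eq_iff by blast
    then have "a / (2 * pi) = b / (2 * pi) + of_int n" by (simp add: field_simps)
    then show ?thesis using periodic1_int[OF assms(2)] by simp
  qed
  have g_Arg: "g z = f (Arg z / (2 * pi))" if "z \<noteq> 0" for z
  proof -
    have "cis (Arg2pi z) = cis (Arg z)"
      using is_Arg_Arg[OF that] Arg2pi_eq[of z] that
      by (metis cis_conv_exp is_Arg_def mult_left_cancel norm_eq_zero of_real_eq_0_iff)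
    then show ?thesis unfolding g_def by (rule cis)
  qed
  have g_cis: "g (cis (2 * pi * x)) = f x" for x
  proof -
    have "cis (Arg (cis (2 * pi * x))) = cis (2 * pi * x)"
      using rcis_cmod_Arg[of "cis (2 * pi * x)"] by (simp add: rcis_def)
    then show ?thesis using cis g_Arg[of "cis (2 * pi * x)"] by fastforce
  qed
  have f_at: "isCont f x" for x using assms(1) by (simp add: continuous_on_eq_continuous_at)
  have cont: "isCont g z" if "z \<noteq> 0" for z
  \<comment> \<open>\<open>Arg2pi\<close> jumps across the nonnegative real axis and
    \<open>Arg\<close> across the nonpositive one. Away from 0 at least one of them is continuous,
    and both represent \<open>g\<close>.\<close>
  proof (cases "z \<in> \<real>\<^sub>\<ge>\<^sub>0")
    case False
    then have "isCont (\<lambda>z. Arg2pi z / (2 * pi)) z"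
      by (intro continuous_intros continuous_at_Arg2pi) auto
    then show ?thesis unfolding g_def by (rule isCont_o2) (rule f_at)
  next
    case True
    then have "z \<notin> \<real>\<^sub>\<le>\<^sub>0" using that by (auto simp: complex_nonneg_Reals_iff complex_nonpos_Reals_iff complex_eq_iff)
    then have "isCont (\<lambda>z. Arg z / (2 * pi)) z"
      by (intro continuous_intros continuous_at_Arg) auto
    then have "isCont (\<lambda>z. f (Arg z / (2 * pi))) z" by (rule isCont_o2) (rule f_at)
    moreover have "\<forall>\<^sub>F w in nhds z. g w = f (Arg w / (2 * pi))"
      using t1_space_nhds[OF that] by eventually_elim (rule g_Arg)
    ultimately show ?thesis by (simp add: isCont_cong)
  qed
  have "continuous_on (sphere 0 1) g"
  proof (intro continuous_at_imp_continuous_on ballI cont)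
    fix z :: complex
    assume "z \<in> sphere 0 1"
    then show "z \<noteq> 0" by force
  qed
  then obtain h where h: "real_polynomial_function h" "\<And>z. z \<in> sphere 0 1 \<Longrightarrow> \<bar>g z - h z\<bar> < e"
    using Stone_Weierstrass_real_polynomial_function[of "sphere 0 1" g e] assms(3) by auto
  show ?thesis
  proof (rule that)
    show "trig_poly (\<lambda>x. complex_of_real (h (cis (2 * pi * x))))"
      by (rule trig_poly_of_real_polynomial) fact
    show "\<bar>f x - h (cis (2 * pi * x))\<bar> < e" for x
      using h(2)[of "cis (2 * pi * x)"] g_cis by simp
    have "continuous_on UNIV h"
      using h(1) continuous_on_polymonial_function real_polynomial_function_eq by blast
    then show "continuous_on UNIV (\<lambda>x. h (cis (2 * pi * x)))"
      by (rule continuous_on_compose2) (auto intro!: continuous_intros)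
  qed
qed

lemma integral_of_real_continuous:
  fixes f :: "real \<Rightarrow> real"
  assumes "continuous_on {a..b} f"
  shows "integral {a..b} (\<lambda>x. complex_of_real (f x)) = of_real (integral {a..b} f)"
  using integral_linear[OF integrable_continuous_real[OF assms] bounded_linear_of_real]
  by (simp add: o_def)

text \<open>Such an \<open>f\<close> is orthogonal to every trigonometric polynomial
  \<open>P\<close>. Hence the integral of f^2 equals that of f (f - P), which is at most
  \<open>e\<close> times the integral of |f| when \<open>P\<close> approximates \<open>f\<close>
  within \<open>e\<close>.\<close>

lemma fourier_coeff_unique:
  assumes "continuous_on UNIV f" "periodic1 f" "\<And>k. fourier_coeff f k = 0"
  shows "f x = 0"
proof -
  note [continuous_intros] = continuous_on_subset[OF assms(1) subset_UNIV]
  \<comment> \<open>Continuity of \<open>P\<close> is carried along because the additive step has to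
    split an integral.\<close>
  have orth: "integral {0..1} (\<lambda>x. complex_of_real (f x) * P x) = 0 \<and> continuous_on UNIV P"
    if "trig_poly P" for P
    using that
  proof induction
    case (trig_poly_mono a k)
    have "integral {0..1} (\<lambda>x. complex_of_real (f x) * (a * cis (2 * pi * of_int k * x))) =
        a * fourier_coeff f (- k)"
      unfolding fourier_coeff_continuous[OF assms(1)] integral_mult_right [symmetric]
      by (simp add: algebra_simps)
    then show ?case using assms(3) by (auto intro!: continuous_intros)
  next
    case (trig_poly_add P Q)
    then have c: "continuous_on {0..1} P" "continuous_on {0..1} Q"
      using continuous_on_subset by blast+
    have "integral {0..1} (\<lambda>x. complex_of_real (f x) * P x + complex_of_real (f x) * Q x) =
      integral {0..1} (\<lambda>x. complex_of_real (f x) * P x) + integral {0..1} (\<lambda>x. complex_of_real (f x) * Q x)"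
      by (intro integral_add integrable_continuous_real continuous_intros c)
    then show ?case using trig_poly_add by (auto simp: distrib_left intro!: continuous_intros)
  qed
  define A where "A = integral {0..1} (\<lambda>x. \<bar>f x\<bar>)"
  define B where "B = integral {0..1} (\<lambda>x. f x * f x)"
  have A: "A \<ge> 0" unfolding A_def
    by (intro integral_nonneg integrable_continuous_real continuous_intros) auto
  have B: "B \<ge> 0" unfolding B_def
    by (intro integral_nonneg integrable_continuous_real continuous_intros) auto
  have le: "B \<le> e * A" if e: "e > 0" for e
  proof -
    obtain P where P: "trig_poly (\<lambda>x. complex_of_real (P x))" "\<And>x. \<bar>f x - P x\<bar> < e"
      "continuous_on UNIV P"
      using trig_poly_approx[OF assms(1,2) e] by blast
    note [continuous_intros] = continuous_on_subset[OF P(3) subset_UNIV]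
    have "complex_of_real (integral {0..1} (\<lambda>x. f x * P x)) = 0"
      using orth[OF P(1)]
      by (subst integral_of_real_continuous [symmetric]) (auto intro!: continuous_intros)
    then have "B = integral {0..1} (\<lambda>x. f x * f x) - integral {0..1} (\<lambda>x. f x * P x)"
      by (simp add: B_def)
    also have "\<dots> = integral {0..1} (\<lambda>x. f x * f x - f x * P x)"
      by (intro integral_diff [symmetric] integrable_continuous_real continuous_intros)
    also have "\<dots> \<le> integral {0..1} (\<lambda>x. e * \<bar>f x\<bar>)"
    proof (intro integral_le integrable_continuous_real continuous_intros)
      fix x
      have "f x * f x - f x * P x \<le> \<bar>f x\<bar> * \<bar>f x - P x\<bar>"
        by (metis abs_ge_self abs_mult right_diff_distrib)
      also have "\<dots> \<le> e * \<bar>f x\<bar>"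
        using P(2)[of x] by (subst mult.commute) (intro mult_right_mono, auto)
      finally show "f x * f x - f x * P x \<le> e * \<bar>f x\<bar>" .
    qed
    finally show ?thesis by (simp add: A_def)
  qed
  have "B = 0"
  proof (rule ccontr)
    assume "B \<noteq> 0"
    with B have "B > 0" by simp
    \<comment> \<open>The choice \<open>e = B / (2 * (A + 1))\<close> makes the bound smaller than
      \<open>B\<close>; the summand 1 keeps the denominator positive when
      \<open>A = 0\<close>.\<close>
    have "B \<le> B / (2 * (A + 1)) * A" using \<open>B > 0\<close> A by (intro le) auto
    also have "\<dots> < B" using \<open>B > 0\<close> A by (simp add: field_simps add_nonneg_pos)
    finally show False by simp
  qed
  then have "\<forall>x\<in>{0..1}. f x * f x = 0"
    unfolding B_def by (subst (asm) integral_eq_0_iff) (auto intro!: continuous_intros)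
  moreover have "frac x \<in> {0..1}" using frac_lt_1[of x] by simp
  ultimately show ?thesis using periodic1_frac[OF assms(2)] by (metis mult_eq_0_iff)
qed

section \<open>Absolutely convergent Fourier series and Sobolev embeddings\<close>

lemma has_vector_derivative_cis_linear:
  "((\<lambda>x. cis (a * x)) has_vector_derivative (\<i> * of_real a * cis (a * x))) (at x within S)"
  unfolding has_vector_derivative_def
  by (rule derivative_eq_intros refl)+ (simp add: scaleR_conv_of_real fun_eq_iff mult_ac)

lemma integral_cis:
  "integral {0..1} (\<lambda>x. cis (2 * pi * of_int k * x)) = (if k = 0 then 1 else 0)"
proof (cases "k = 0")
  case False
  define a where "a = 2 * pi * of_int k"
  have a: "a \<noteq> 0" using False by (simp add: a_def)
  have "((\<lambda>x. \<i> * of_real a * cis (a * x)) has_integral (cis (a * 1) - cis (a * 0))) {0..1}"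
    by (intro fundamental_theorem_of_calculus has_vector_derivative_cis_linear) auto
  moreover have "cis (a * 1) = 1"
    unfolding a_def by (simp add: cis_multiple_2pi)
  ultimately have "integral {0..1} (\<lambda>x. \<i> * of_real a * cis (a * x)) = 0"
    by (auto dest: integral_unique)
  then have "\<i> * of_real a * integral {0..1} (\<lambda>x. cis (a * x)) = 0"
    by (simp only: integral_mult_right)
  then show ?thesis using a False by (simp add: a_def)
qed simp

text \<open>The series converges uniformly by the Weierstrass M-test, so its sum is continuous and
  may be integrated termwise. The symmetry of the coefficients makes the sum real.\<close>

lemma fourier_series_exists:
  fixes c :: "int \<Rightarrow> complex"
  assumes sum: "(\<lambda>k. cmod (c k)) summable_on UNIV" and sym: "\<And>k. c (- k) = cnj (c k)"
  obtains D where "continuous_on UNIV D" "periodic1 D" "\<And>k. fourier_coeff D k = c k"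
    "\<And>x. \<bar>D x\<bar> \<le> (\<Sum>\<^sub>\<infinity>k. cmod (c k))"
proof -
  let ?e = "\<lambda>k x. cis (2 * pi * of_int k * x)"
  define S where "S x = (\<Sum>\<^sub>\<infinity>k. c k * ?e k x)" for x
  have ul: "uniform_limit UNIV (\<lambda>F x. \<Sum>k\<in>F. c k * ?e k x) S (finite_subsets_at_top UNIV)"
    unfolding S_def by (rule Weierstrass_m_test_general[OF _ sum]) (simp add: norm_mult)
  have cont: "continuous_on UNIV S"
    by (rule uniform_limit_theorem[OF _ ul])
      (auto intro!: always_eventually continuous_intros)
  have real: "complex_of_real (Re (S x)) = S x" for x
  proof -
    have "cnj (S x) = (\<Sum>\<^sub>\<infinity>k. c (- k) * ?e (- k) x)"
      unfolding S_def infsum_cnj [symmetric] by (simp add: sym cis_cnj)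
    also have "\<dots> = S x"
      unfolding S_def by (rule infsum_reindex_bij_betw) (rule bij_uminus)
    finally show ?thesis by (simp add: complex_eq_iff)
  qed
  have bound: "\<bar>Re (S x)\<bar> \<le> (\<Sum>\<^sub>\<infinity>k. cmod (c k))" for x
  proof -
    have "cmod (S x) \<le> (\<Sum>\<^sub>\<infinity>k. cmod (c k * ?e k x))"
      unfolding S_def by (rule norm_infsum_bound) (simp add: norm_mult sum)
    then show ?thesis using abs_Re_le_cmod[of "S x"] by (simp add: norm_mult)
  qed
  have coeff: "fourier_coeff (\<lambda>x. Re (S x)) k = c k" for k
  proof -
    have "uniform_limit {0..1} (\<lambda>F x. ?e (- k) x * (\<Sum>j\<in>F. c j * ?e j x)) (\<lambda>x. ?e (- k) x * S x)
        (finite_subsets_at_top UNIV)"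
    proof (rule uniform_lim_mult)
      show "uniform_limit {0..1} (\<lambda>F. ?e (- k)) (?e (- k)) (finite_subsets_at_top UNIV)"
        by (rule uniform_limit_const)
      show "uniform_limit {0..1} (\<lambda>F x. \<Sum>j\<in>F. c j * ?e j x) S (finite_subsets_at_top UNIV)"
        using ul by (rule uniform_limit_on_subset) simp
      show "bounded (?e (- k) ` {0..1})" by (auto simp: bounded_iff)
      show "bounded (S ` {0..1})"
        by (intro compact_imp_bounded compact_continuous_image continuous_on_subset[OF cont]) auto
    qed
    then obtain I J where IJ: "\<And>F. ((\<lambda>x. ?e (- k) x * (\<Sum>j\<in>F. c j * ?e j x)) has_integral I F) {0..1}"
      "((\<lambda>x. ?e (- k) x * S x) has_integral J) {0..1}" "(I \<longlongrightarrow> J) (finite_subsets_at_top UNIV)"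
      by (rule uniform_limit_integral) (auto intro!: continuous_intros)
    \<comment> \<open>By orthogonality the \<open>k\<close>-th coefficient of a partial sum is
      already exact once \<open>k\<close> belongs to the finite index set, so the limit
      \<open>J\<close> is \<open>c k\<close>.\<close>
    have I: "I F = c k" if "finite F" "k \<in> F" for F
    proof -
      have "I F = integral {0..1} (\<lambda>x. \<Sum>j\<in>F. c j * ?e (j - k) x)"
        using IJ(1)[of F, THEN integral_unique]
        by (simp add: sum_distrib_left mult.left_commute cis_mult left_diff_distrib right_diff_distrib algebra_simps)
      also have "\<dots> = (\<Sum>j\<in>F. c j * integral {0..1} (?e (j - k)))"
        by (subst integral_sum)
          (use that in \<open>auto intro!: integrable_continuous_real continuous_intros\<close>)
      also have "\<dots> = (\<Sum>j\<in>F. if j = k then c j else 0)"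
        unfolding integral_cis by (intro sum.cong) auto
      finally show ?thesis using that by simp
    qed
    have "\<forall>\<^sub>F F in finite_subsets_at_top UNIV. I F = c k"
      using eventually_finite_subsets_at_top_weakI[of UNIV "\<lambda>F. True"]
      unfolding eventually_finite_subsets_at_top by (intro exI[of _ "{k}"]) (auto intro: I)
    then have "(I \<longlongrightarrow> c k) (finite_subsets_at_top UNIV)"
      by (rule tendsto_eventually)
    then have "J = c k"
      using IJ(3) tendsto_unique finite_subsets_at_top_neq_bot by blast
    have "continuous_on UNIV (\<lambda>x. Re (S x))" by (intro continuous_intros cont)
    from fourier_coeff_continuous[OF this, of k] show ?thesis
      using IJ(2)[THEN integral_unique] \<open>J = c k\<close> by (simp add: real mult.commute)
  qed
  show ?thesis
  proof (rule that)
    show "continuous_on UNIV (\<lambda>x. Re (S x))" by (intro continuous_intros cont)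
    show "periodic1 (\<lambda>x. Re (S x))" by (simp add: periodic1_def S_def cis_period)
  qed (rule coeff bound)+
qed

lemma fourier_coeff_uminus: "fourier_coeff f (- k) = cnj (fourier_coeff f k)"
  unfolding fourier_coeff_def set_lebesgue_integral_def
  by (subst Bochner_Integration.integral_cnj [symmetric]) (simp add: cis_cnj)

lemma continuous_eq_of_fourier_coeff:
  assumes "continuous_on UNIV f" "periodic1 f" "continuous_on UNIV g" "periodic1 g"
    and "\<And>k. fourier_coeff f k = fourier_coeff g k"
  shows "f = g"
proof
  fix x
  have "1 * f x + (- 1) * g x = 0"
  proof (rule fourier_coeff_unique[where f = "\<lambda>x. 1 * f x + (- 1) * g x"])
    show "continuous_on UNIV (\<lambda>x. 1 * f x + (- 1) * g x)"
      using assms by (intro continuous_intros)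
    show "periodic1 (\<lambda>x. 1 * f x + (- 1) * g x)" using assms by (simp add: periodic1_def)
    show "fourier_coeff (\<lambda>x. 1 * f x + (- 1) * g x) k = 0" for k
      using assms by (subst fourier_coeff_lincomb) (auto intro: set_integrable_period)
  qed
  then show "f x = g x" by simp
qed

text \<open>The sum of the Fourier series of \<open>f\<close> is continuous with the same
  coefficients, so by uniqueness it is \<open>f\<close> and inherits the termwise bound.\<close>

lemma sup_le_sum_fourier_coeff:
  assumes "continuous_on UNIV f" "periodic1 f" "(\<lambda>k. cmod (fourier_coeff f k)) summable_on UNIV"
  shows "\<bar>f x\<bar> \<le> (\<Sum>\<^sub>\<infinity>k. cmod (fourier_coeff f k))"
proof -
  obtain D where D: "continuous_on UNIV D" "periodic1 D" "\<And>k. fourier_coeff D k = fourier_coeff f k"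
    "\<And>x. \<bar>D x\<bar> \<le> (\<Sum>\<^sub>\<infinity>k. cmod (fourier_coeff f k))"
    using fourier_series_exists[of "fourier_coeff f"] assms(3) fourier_coeff_uminus by metis
  have "f = D" using assms D by (intro continuous_eq_of_fourier_coeff) auto
  then show ?thesis using D(4) by simp
qed

text \<open>Integration by parts: the derivative of \<open>g\<close> times the character integrates
  to zero over a period, since the boundary values agree.\<close>

lemma fourier_coeff_deriv:
  assumes g: "\<And>x. (g has_real_derivative g' x) (at x)" and g': "continuous_on UNIV g'"
    and per: "periodic1 g"
  shows "fourier_coeff g' k = 2 * pi * of_int k * \<i> * fourier_coeff g k"
proof -
  let ?a = "- (2 * pi * of_int k)"
  have cont: "continuous_on UNIV g"
    using g DERIV_isCont continuous_at_imp_continuous_on by blast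
  note [continuous_intros] = continuous_on_subset[OF cont subset_UNIV] continuous_on_subset[OF g' subset_UNIV]
  have "((\<lambda>x. of_real (g x) * (\<i> * of_real ?a * cis (?a * x)) + of_real (g' x) * cis (?a * x)) has_integral
      (of_real (g 1) * cis (?a * 1) - of_real (g 0) * cis (?a * 0))) {0..1}"
  proof (rule fundamental_theorem_of_calculus)
    fix x
    have "((\<lambda>x. complex_of_real (g x)) has_vector_derivative of_real (g' x)) (at x within {0..1})"
      using g[of x] by (intro has_vector_derivative_of_real)
        (simp add: has_field_derivative_at_within)
    then show "((\<lambda>x. of_real (g x) * cis (?a * x)) has_vector_derivative
        (of_real (g x) * (\<i> * of_real ?a * cis (?a * x)) + of_real (g' x) * cis (?a * x))) (at x within {0..1})"
      by (intro has_vector_derivative_mult has_vector_derivative_cis_linear)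
  qed simp
  moreover have "cis (?a * 1) = 1"
    using cis_multiple_2pi[of "of_int (- k)"] by simp
  moreover have "g 1 = g 0" using per[unfolded periodic1_def, rule_format, of 0] by simp
  ultimately have "0 = integral {0..1} (\<lambda>x. of_real (g x) * (\<i> * of_real ?a * cis (?a * x)) + of_real (g' x) * cis (?a * x))"
    by (simp add: integral_unique)
  also have "\<dots> = integral {0..1} (\<lambda>x. (\<i> * of_real ?a) * (of_real (g x) * cis (?a * x)))
      + integral {0..1} (\<lambda>x. of_real (g' x) * cis (?a * x))"
    by (subst integral_add [symmetric])
      (auto intro!: integrable_continuous_real continuous_intros simp: mult_ac)
  also have "\<dots> = \<i> * of_real ?a * fourier_coeff g k + fourier_coeff g' k"
    unfolding fourier_coeff_continuous[OF cont] fourier_coeff_continuous[OF g'] by simp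
  finally show ?thesis by (simp add: algebra_simps)
qed

lemma continuous_antiderivative:
  fixes f :: "real \<Rightarrow> real"
  assumes "continuous_on UNIV f"
  obtains g where "\<And>x. (g has_real_derivative f x) (at x)"
proof -
  have "isCont f x" for x using assms by (simp add: continuous_on_eq_continuous_at)
  then have "\<exists>F. \<forall>x :: real. - \<infinity> < ereal x \<longrightarrow> ereal x < \<infinity> \<longrightarrow> (F has_vector_derivative f x) (at x)"
    by (intro einterval_antiderivative) auto
  then show ?thesis using that by (auto simp: has_real_derivative_iff_has_vector_derivative)
qed

text \<open>The increment \<open>g (x + 1) - g x\<close> does not depend on \<open>x\<close>, and at
  0 it is the mean of \<open>f\<close>.\<close>

lemma periodic1_antiderivative:
  assumes g: "\<And>x. (g has_real_derivative f x) (at x)" and f: "continuous_on UNIV f" "periodic1 f"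
    and mean: "fourier_coeff f 0 = 0"
  shows "periodic1 g"
proof -
  have "((\<lambda>x. g (x + 1) - g x) has_real_derivative 0) (at x)" for x
    using f(2) by (auto intro!: derivative_eq_intros DERIV_chain'[OF _ g] g simp: periodic1_def)
  then obtain c where c: "\<And>x. g (x + 1) - g x = c"
    using has_field_derivative_zero_constant[of UNIV "\<lambda>x. g (x + 1) - g x"] by auto
  have "(f has_integral (g 1 - g 0)) {0..1}"
    using g by (intro fundamental_theorem_of_calculus)
      (auto simp: has_real_derivative_iff_has_vector_derivative [symmetric] has_field_derivative_at_within)
  moreover have "complex_of_real (integral {0..1} f) = 0"
    using mean unfolding fourier_coeff_continuous[OF f(1)]
    by (subst integral_of_real_continuous [symmetric]) (auto intro: continuous_on_subset[OF f(1)])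
  ultimately have "c = 0" using c[of 0] by (simp add: integral_unique)
  then show ?thesis using c by (simp add: periodic1_def)
qed

text \<open>The formally differentiated series converges to a continuous \<open>D\<close> of mean
  zero. Its periodic antiderivative has the coefficients of \<open>f\<close> except perhaps at 0, so
  it differs from \<open>f\<close> by a constant.\<close>

lemma continuous_differentiable_of_fourier_coeff:
  assumes f: "continuous_on UNIV f" "periodic1 f"
    and sum: "(\<lambda>k. cmod (2 * pi * of_int k * \<i> * fourier_coeff f k)) summable_on UNIV"
  obtains D where "continuous_on UNIV D" "periodic1 D" "\<And>x. (f has_real_derivative D x) (at x)"
proof -
  define c where "c k = complex_of_real (2 * pi * of_int k) * \<i> * fourier_coeff f k" for k
  have c: "(\<lambda>k. cmod (c k)) summable_on UNIV" "\<And>k. c (- k) = cnj (c k)"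
    using sum by (simp_all add: c_def fourier_coeff_uminus)
  obtain D where D: "continuous_on UNIV D" "periodic1 D" "\<And>k. fourier_coeff D k = c k"
    using fourier_series_exists[of c] c by metis
  obtain g where g: "\<And>x. (g has_real_derivative D x) (at x)"
    using continuous_antiderivative[OF D(1)] by blast
  have "periodic1 g" by (rule periodic1_antiderivative[OF g D(1,2)]) (simp add: D(3) c_def)
  have contg: "continuous_on UNIV g"
    using g DERIV_isCont continuous_at_imp_continuous_on by blast
  have coeff: "fourier_coeff g k = fourier_coeff f k" if "k \<noteq> 0" for k
    using fourier_coeff_deriv[OF g D(1) \<open>periodic1 g\<close>, of k] D(3)[of k] that by (simp add: c_def)
  define m where "m = Re (fourier_coeff f 0 - fourier_coeff g 0)"
  \<comment> \<open>A coefficient at frequency 0 equals its own conjugate, so taking the real part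
    loses nothing.\<close>
  have m: "complex_of_real m = fourier_coeff f 0 - fourier_coeff g 0"
    using fourier_coeff_uminus[of f 0] fourier_coeff_uminus[of g 0]
    by (simp add: m_def complex_eq_iff)
  have one: "fourier_coeff (\<lambda>x. 1) k = (if k = 0 then 1 else 0)" for k
    using integral_cis[of "- k"] by (subst fourier_coeff_continuous) auto
  have "f = (\<lambda>x. 1 * g x + m * 1)"
  proof (rule continuous_eq_of_fourier_coeff[OF f])
    show "continuous_on UNIV (\<lambda>x. 1 * g x + m * 1)" by (intro continuous_intros contg)
    show "periodic1 (\<lambda>x. 1 * g x + m * 1)" using \<open>periodic1 g\<close> by (simp add: periodic1_def)
    show "fourier_coeff f k = fourier_coeff (\<lambda>x. 1 * g x + m * 1) k" for k
      using coeff[of k] by (subst fourier_coeff_lincomb) (auto intro: set_integrable_period contg simp: one m)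
  qed
  moreover have "((\<lambda>x. 1 * g x + m * 1) has_real_derivative D x) (at x)" for x
    by (auto intro!: derivative_eq_intros g)
  ultimately show ?thesis using that D by metis
qed

lemma summable_on_int_powr:
  assumes "r > 1 / 2"
  shows "(\<lambda>k::int. (1 + (2 * pi * of_int k)\<^sup>2) powr (- r)) summable_on UNIV"
proof -
  let ?w = "\<lambda>k::int. (1 + (2 * pi * of_int k)\<^sup>2) powr (- r)"
  \<comment> \<open>The weight is compared with n^(-2r), which is summable since 2r > 1. At
    \<open>n = 0\<close> the weight is 1 while \<open>0 powr _\<close> is 0, hence the extra
    term.\<close>
  have le: "?w (int n) \<le> real n powr (- (2 * r)) + (if n = 0 then 1 else 0)" for n
  proof (cases "n = 0")
    case False
    have "(real n)\<^sup>2 \<le> (2 * pi * n)\<^sup>2"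
      using pi_ge_two by (intro power_mono) (auto simp: mult_le_cancel_right1)
    then have "(real n)\<^sup>2 \<le> 1 + (2 * pi * of_int (int n))\<^sup>2"
      unfolding of_int_of_nat_eq by linarith
    then have "?w (int n) \<le> ((real n)\<^sup>2) powr (- r)"
      using False assms by (intro powr_mono2') (simp_all only: zero_less_power2 of_nat_eq_0_iff, simp_all)
    also have "((real n)\<^sup>2) powr (- r) = real n powr (- (2 * r))"
      using False by (simp add: powr_powr flip: powr_numeral)
    finally show ?thesis using False by simp
  qed simp
  have "summable (\<lambda>n. real n powr (- (2 * r)) + (if n = 0 then 1 else 0))"
    using assms by (intro summable_add) (auto simp: summable_real_powr_iff)
  then have "(\<lambda>n. real n powr (- (2 * r)) + (if n = 0 then 1 else 0)) summable_on UNIV"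
    by (subst summable_on_UNIV_nonneg_real_iff) auto
  then have "(\<lambda>n. ?w (int n)) summable_on UNIV"
    by (rule summable_on_comparison_test) (use le in auto)
  then have nat: "(\<lambda>n. ?w (int n)) summable_on A" for A
    by (rule summable_on_subset_banach) simp
  have "?w summable_on (int ` UNIV \<union> (\<lambda>n. - int n) ` {0<..})"
  proof (rule summable_on_Un_disjoint)
    show "?w summable_on int ` UNIV"
      using nat[of UNIV] by (subst summable_on_reindex) (auto simp: o_def)
    show "?w summable_on (\<lambda>n. - int n) ` {0<..}"
      using nat[of "{0<..}"] by (subst summable_on_reindex) (auto simp: o_def inj_on_def)
  qed auto
  moreover have "int ` UNIV \<union> (\<lambda>n. - int n) ` {0<..} = UNIV"
  proof -
    have "k \<in> int ` UNIV \<union> (\<lambda>n. - int n) ` {0<..}" for k :: int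
    proof (cases "k \<ge> 0")
      case True
      then have "k = int (nat k)" by simp
      then show ?thesis by blast
    next
      case False
      then have "k = - int (nat (- k))" "nat (- k) \<in> {0<..}" by auto
      then show ?thesis by blast
    qed
    then show ?thesis by blast
  qed
  ultimately show ?thesis by simp
qed

text \<open>Cauchy--Schwarz against the weights \<open>(1 + (2 \<pi> k)\<^sup>2) powr (- r)\<close>.\<close>

lemma weighted_square_summable:
  assumes "r > 1 / 2"
  obtains C where "\<And>c :: int \<Rightarrow> complex. (\<lambda>k. (1 + (2 * pi * of_int k)\<^sup>2) powr r * (cmod (c k))\<^sup>2) summable_on UNIV \<Longrightarrow>
    (\<lambda>k. cmod (c k)) summable_on UNIV \<and>
    (\<Sum>\<^sub>\<infinity>k. cmod (c k)) \<le> C * sqrt (\<Sum>\<^sub>\<infinity>k. (1 + (2 * pi * of_int k)\<^sup>2) powr r * (cmod (c k))\<^sup>2)"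
proof
  let ?w = "\<lambda>k::int. 1 + (2 * pi * of_int k)\<^sup>2"
  \<comment> \<open>The constant is the l2 norm of the inverse square-root weights, finite because
    \<open>r > 1 / 2\<close>, and it is fixed before the sequence \<open>c\<close>.\<close>
  define C where "C = sqrt (\<Sum>\<^sub>\<infinity>k. ?w k powr (- r))"
  fix c :: "int \<Rightarrow> complex"
  assume sum: "(\<lambda>k. ?w k powr r * (cmod (c k))\<^sup>2) summable_on UNIV"
  let ?N = "sqrt (\<Sum>\<^sub>\<infinity>k. ?w k powr r * (cmod (c k))\<^sup>2)"
  have w: "?w k > 0" for k by (rule add_pos_nonneg) auto
  have fin: "(\<Sum>k\<in>F. cmod (c k)) \<le> C * ?N" if "finite F" for F
  proof -
    have "(\<Sum>k\<in>F. cmod (c k)) = (\<Sum>k\<in>F. \<bar>?w k powr (- r / 2)\<bar> * \<bar>?w k powr (r / 2) * cmod (c k)\<bar>)"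
    proof (rule sum.cong)
      fix k
      have "?w k powr (- r / 2) * ?w k powr (r / 2) = 1"
        using w[of k] by (simp flip: powr_add)
      then show "cmod (c k) = \<bar>?w k powr (- r / 2)\<bar> * \<bar>?w k powr (r / 2) * cmod (c k)\<bar>"
        by (simp add: abs_mult flip: mult.assoc)
    qed simp
    also have "\<dots> \<le> L2_set (\<lambda>k. ?w k powr (- r / 2)) F * L2_set (\<lambda>k. ?w k powr (r / 2) * cmod (c k)) F"
      by (rule L2_set_mult_ineq)
    also have "\<dots> \<le> C * ?N"
    proof (rule mult_mono)
      have sq: "(?w k powr a)\<^sup>2 = ?w k powr (2 * a)" for k a
        using w[of k] by (simp add: power2_eq_square flip: powr_add)
      show "L2_set (\<lambda>k. ?w k powr (- r / 2)) F \<le> C"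
        unfolding L2_set_def C_def sq
        using finite_sum_le_infsum[OF summable_on_int_powr[OF assms] that] by simp
      show "L2_set (\<lambda>k. ?w k powr (r / 2) * cmod (c k)) F \<le> ?N"
        unfolding L2_set_def power_mult_distrib[of "?w _ powr (r / 2)"] sq
        using finite_sum_le_infsum[OF sum that] by simp
    qed (auto simp: C_def L2_set_nonneg infsum_nonneg)
    finally show ?thesis .
  qed
  have abs: "(\<lambda>k. cmod (c k)) summable_on UNIV"
    by (rule nonneg_bdd_above_summable_on) (auto intro!: bdd_aboveI fin)
  then show "(\<lambda>k. cmod (c k)) summable_on UNIV \<and> (\<Sum>\<^sub>\<infinity>k. cmod (c k)) \<le> C * ?N"
    using infsum_le_finite_sums[OF abs fin] by blast
qed

text \<open>The embedding of H^r into the continuous functions. The constant is uniform in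
  \<open>f\<close> and \<open>x\<close>, so that convergence in norm yields uniform
  convergence.\<close>

lemma sobolev_sup_bound:
  assumes "r > 1 / 2"
  obtains C where "\<And>f x. continuous_on UNIV f \<Longrightarrow> periodic1 f \<Longrightarrow> sobolev_term r f summable_on UNIV
    \<Longrightarrow> \<bar>f x\<bar> \<le> C * sobolev_norm r f"
proof -
  obtain C where C: "\<And>c :: int \<Rightarrow> complex. (\<lambda>k. (1 + (2 * pi * of_int k)\<^sup>2) powr r * (cmod (c k))\<^sup>2) summable_on UNIV \<Longrightarrow>
    (\<lambda>k. cmod (c k)) summable_on UNIV \<and>
    (\<Sum>\<^sub>\<infinity>k. cmod (c k)) \<le> C * sqrt (\<Sum>\<^sub>\<infinity>k. (1 + (2 * pi * of_int k)\<^sup>2) powr r * (cmod (c k))\<^sup>2)"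
    using weighted_square_summable[OF assms] by blast
  show ?thesis
  proof (rule that)
    fix f x
    assume f: "continuous_on UNIV f" "periodic1 f" "sobolev_term r f summable_on UNIV"
    have "(\<lambda>k. cmod (fourier_coeff f k)) summable_on UNIV"
      "(\<Sum>\<^sub>\<infinity>k. cmod (fourier_coeff f k)) \<le> C * sobolev_norm r f"
      using C[of "fourier_coeff f"] f(3) unfolding sobolev_norm_def sobolev_term_def by auto
    then show "\<bar>f x\<bar> \<le> C * sobolev_norm r f"
      using sup_le_sum_fourier_coeff[OF f(1,2), of x] by linarith
  qed
qed

text \<open>Differentiation multiplies the coefficients by 2 pi i k, whose squared modulus is at
  most the weight. The differentiated coefficients thus have a finite norm of order
  \<open>s - 1 > 1 / 2\<close> and are absolutely summable.\<close>

lemma sobolev_C1_embedding: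
  assumes "s > 3 / 2" "f \<in> sobolev s" "continuous_on UNIV f"
  shows "continuous_on UNIV (deriv f)" "periodic1 (deriv f)" "(f has_real_derivative deriv f x) (at x)"
proof -
  let ?w = "\<lambda>k::int. 1 + (2 * pi * of_int k)\<^sup>2"
  have f: "periodic1 f" "sobolev_term s f summable_on UNIV" using assms(2) by (auto simp: sobolev_def)
  have "(\<lambda>k. ?w k powr (s - 1) * (cmod (2 * pi * of_int k * \<i> * fourier_coeff f k))\<^sup>2) summable_on UNIV"
  proof (rule summable_on_comparison_test[OF f(2)])
    fix k
    have w: "?w k > 0" by (rule add_pos_nonneg) auto
    have "?w k powr (s - 1) * (cmod (2 * pi * of_int k * \<i> * fourier_coeff f k))\<^sup>2 =
        ?w k powr (s - 1) * ((2 * pi * of_int k)\<^sup>2 * (cmod (fourier_coeff f k))\<^sup>2)"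
      by (simp add: norm_mult power_mult_distrib)
    also have "\<dots> \<le> ?w k powr (s - 1) * (?w k * (cmod (fourier_coeff f k))\<^sup>2)"
      by (intro mult_left_mono mult_right_mono) auto
    also have "\<dots> = ?w k powr (s - 1) * ?w k powr 1 * (cmod (fourier_coeff f k))\<^sup>2"
      using w by simp
    also have "\<dots> = sobolev_term s f k"
      unfolding sobolev_term_def powr_add [symmetric] by simp
    finally show "?w k powr (s - 1) * (cmod (2 * pi * of_int k * \<i> * fourier_coeff f k))\<^sup>2 \<le> sobolev_term s f k" .
  qed simp
  moreover have "s - 1 > 1 / 2" using assms(1) by simp
  ultimately have "(\<lambda>k. cmod (2 * pi * of_int k * \<i> * fourier_coeff f k)) summable_on UNIV"
    using weighted_square_summable[of "s - 1"] by meson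
  then obtain D where D: "continuous_on UNIV D" "periodic1 D" "\<And>x. (f has_real_derivative D x) (at x)"
    using continuous_differentiable_of_fourier_coeff[OF assms(3) f(1)] by blast
  moreover have "deriv f = D" using D(3) by (intro ext DERIV_imp_deriv)
  ultimately show "continuous_on UNIV (deriv f)" "periodic1 (deriv f)" "(f has_real_derivative deriv f x) (at x)"
    by simp_all
qed

section \<open>The inverse Helmholtz operator\<close>

lemma periodic1_derivative:
  assumes "periodic1 w" "\<And>x. (w has_real_derivative w' x) (at x)"
  shows "periodic1 w'"
  unfolding periodic1_def
proof
  fix x
  have "((\<lambda>x. w (x + 1)) has_real_derivative w' (x + 1)) (at x)"
    using assms(2)[of "x + 1"] by (simp add: DERIV_shift)
  moreover have "(\<lambda>x. w (x + 1)) = w" using assms(1) by (auto simp: periodic1_def)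
  ultimately show "w' (x + 1) = w' x" using assms(2) DERIV_unique by metis
qed

text \<open>Variation of constants gives all solutions exp(ax) (A + C); since
  \<open>a \<noteq> 0\<close>, the free constant can be chosen to make the solution
  periodic.\<close>

lemma periodic_linear_ode_exists:
  fixes a :: real
  assumes "a \<noteq> 0" "continuous_on UNIV f" "periodic1 f"
  obtains g where "periodic1 g" "\<And>x. (g has_real_derivative a * g x + f x) (at x)"
proof -
  have "continuous_on UNIV (\<lambda>x. exp (- a * x) * f x)" by (intro continuous_intros assms)
  then obtain A where A: "\<And>x. (A has_real_derivative exp (- a * x) * f x) (at x)"
    using continuous_antiderivative by blast
  have "((\<lambda>x. A (x + 1) - exp (- a) * A x) has_real_derivative 0) (at x)" for x
  proof -
    have "((\<lambda>x. A (x + 1)) has_real_derivative exp (- a * (x + 1)) * f (x + 1)) (at x)"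
      using A[of "x + 1"] by (simp add: DERIV_shift)
    moreover have "exp (- a * (x + 1)) * f (x + 1) = exp (- a) * (exp (- a * x) * f x)"
    proof -
      have "exp (- a * (x + 1)) = exp (- a) * exp (- a * x)"
        by (simp add: algebra_simps flip: exp_add)
      then show ?thesis using assms(3) by (simp add: periodic1_def)
    qed
    ultimately show ?thesis
      using DERIV_diff[OF _ DERIV_cmult[OF A[of x], of "exp (- a)"]] by fastforce
  qed
  then obtain K where K: "\<And>x. A (x + 1) - exp (- a) * A x = K"
    using has_field_derivative_zero_constant[of UNIV "\<lambda>x. A (x + 1) - exp (- a) * A x"] by auto
  \<comment> \<open>Periodicity requires exp(a) (A(x + 1) + C) = A(x) + C. With A(x + 1) = exp(-a)
    A(x) + K this becomes C (1 - exp(a)) = exp(a) K.\<close>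
  define C where "C = exp a * K / (1 - exp a)"
  have C: "C * (1 - exp a) = exp a * K" using assms(1) by (simp add: C_def)
  show ?thesis
  proof (rule that)
    show "periodic1 (\<lambda>x. exp (a * x) * (A x + C))"
      unfolding periodic1_def
    proof
      fix x
      have "A (x + 1) = exp (- a) * A x + K" using K[of x] by simp
      then have "exp a * (A (x + 1) + C) = exp a * exp (- a) * A x + (exp a * K + exp a * C)"
        by (simp only: algebra_simps)
      also have "\<dots> = A x + C" using C by (simp add: algebra_simps flip: exp_add)
      finally have "exp a * (A (x + 1) + C) = A x + C" .
      then show "exp (a * (x + 1)) * (A (x + 1) + C) = exp (a * x) * (A x + C)"
        by (simp only: distrib_left[of a] mult_1_right exp_add mult.assoc)
    qed
    show "((\<lambda>x. exp (a * x) * (A x + C)) has_real_derivative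
        a * (exp (a * x) * (A x + C)) + f x) (at x)" for x
      by (auto intro!: derivative_eq_intros A simp: algebra_simps exp_minus)
  qed
qed

text \<open>Solutions are multiples of exp(ax), and for \<open>a \<noteq> 0\<close> only the zero
  multiple is periodic.\<close>

lemma periodic_linear_ode_unique:
  fixes a :: real
  assumes "a \<noteq> 0" "periodic1 z" "\<And>x. (z has_real_derivative a * z x) (at x)"
  shows "z x = 0"
proof -
  have "((\<lambda>x. exp (- a * x) * z x) has_real_derivative 0) (at x)" for x
    by (auto intro!: derivative_eq_intros assms(3))
  then obtain c where c: "\<And>x. exp (- a * x) * z x = c"
    using has_field_derivative_zero_constant[of UNIV "\<lambda>x. exp (- a * x) * z x"] by auto
  have "z 1 = z 0" using assms(2)[unfolded periodic1_def, rule_format, of 0] by simp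
  then have "exp (- a) * z 0 = z 0" using c[of 0] c[of 1] by simp
  then have "z 0 = 0" using assms(1) by simp
  then show ?thesis using c[of 0] c[of x] by simp
qed

text \<open>\<open>1 - \<partial>\<^sub>x\<^sup>2 = (1 - \<partial>\<^sub>x) (1 + \<partial>\<^sub>x)\<close> reduces the equation to two periodic first order ones.\<close>

lemma inv_helmholtz_solves:
  assumes "continuous_on UNIV f" "periodic1 f"
  defines "w \<equiv> inv_helmholtz f"
  shows "periodic1 w" "(w has_real_derivative deriv w x) (at x)"
    "(deriv w has_real_derivative w x - f x) (at x)"
proof -
  let ?P = "\<lambda>w. periodic1 w \<and> (\<exists>w' w''. \<forall>x. (w has_real_derivative w' x) (at x) \<and>
        (w' has_real_derivative w'' x) (at x) \<and> w x - w'' x = f x)"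
  \<comment> \<open>Here \<open>h\<close> plays the role of w + w', for which h - h' = f; then
    \<open>w0\<close> is recovered from w0' = - w0 + h.\<close>
  obtain h where h: "periodic1 h" "\<And>x. (h has_real_derivative 1 * h x + (- f x)) (at x)"
    using periodic_linear_ode_exists[of 1 "\<lambda>x. - f x"] assms(1,2)
    by (auto simp: periodic1_def intro: continuous_intros)
  have "continuous_on UNIV h"
    using h(2) DERIV_isCont continuous_at_imp_continuous_on by blast
  then obtain w0 where w0: "periodic1 w0" "\<And>x. (w0 has_real_derivative (- 1) * w0 x + h x) (at x)"
    using periodic_linear_ode_exists[of "- 1" h] h(1) by auto
  have "((\<lambda>x. (- 1) * w0 x + h x) has_real_derivative w0 x - f x) (at x)" for x
    by (auto intro!: derivative_eq_intros w0(2) h(2))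
  then have "?P w0" using w0
    by (intro conjI exI[of _ "\<lambda>x. (- 1) * w0 x + h x"] exI[of _ "\<lambda>x. w0 x - f x"]) auto
  moreover have "v = w0" if v0: "?P v" for v
  proof -
    obtain v' v'' where v: "periodic1 v" "\<And>x. (v has_real_derivative v' x) (at x)"
      "\<And>x. (v' has_real_derivative v'' x) (at x)" "\<And>x. v x - v'' x = f x"
      using v0 by blast
    obtain u' u'' where u: "\<And>x. (w0 has_real_derivative u' x) (at x)"
      "\<And>x. (u' has_real_derivative u'' x) (at x)" "\<And>x. w0 x - u'' x = f x"
      using \<open>?P w0\<close> by blast
    have per: "periodic1 v'" "periodic1 u'"
      using periodic1_derivative[OF v(1,2)] periodic1_derivative[OF w0(1) u(1)] by auto
    \<comment> \<open>For the difference z of two solutions, z + z' solves y' = y and so vanishes;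
      then z' = - z, so z vanishes too.\<close>
    have d: "(v x - w0 x) + (v' x - u' x) = 0" for x
    proof (rule periodic_linear_ode_unique[of 1 "\<lambda>x. (v x - w0 x) + (v' x - u' x)"])
      show "periodic1 (\<lambda>x. (v x - w0 x) + (v' x - u' x))"
        using v(1) w0(1) per by (simp add: periodic1_def)
      show "((\<lambda>x. (v x - w0 x) + (v' x - u' x)) has_real_derivative
          1 * ((v x - w0 x) + (v' x - u' x))) (at x)" for x
        using v(4)[of x] u(3)[of x] by (auto intro!: derivative_eq_intros v(2,3) u(1,2))
    qed simp
    have "v x - w0 x = 0" for x
    proof (rule periodic_linear_ode_unique[of "- 1" "\<lambda>x. v x - w0 x"])
      show "periodic1 (\<lambda>x. v x - w0 x)" using v(1) w0(1) by (simp add: periodic1_def)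
      show "((\<lambda>x. v x - w0 x) has_real_derivative (- 1) * (v x - w0 x)) (at x)" for x
        using d[of x] by (auto intro!: derivative_eq_intros v(2) u(1))
    qed simp
    then show ?thesis by auto
  qed
  ultimately have "?P w" unfolding w_def inv_helmholtz_def by (rule theI)
  then obtain w' w'' where w: "\<And>x. (w has_real_derivative w' x) (at x)"
      "\<And>x. (w' has_real_derivative w'' x) (at x)" "\<And>x. w x - w'' x = f x"
    by blast
  have "w' = deriv w" by (rule ext) (rule DERIV_imp_deriv[OF w(1), symmetric])
  moreover have "w'' x = w x - f x" for x using w(3)[of x] by simp
  ultimately show "periodic1 w" "(w has_real_derivative deriv w x) (at x)"
    "(deriv w has_real_derivative w x - f x) (at x)"
    using \<open>?P w\<close> w(1,2) by auto
qed

text \<open>Double vanishing at \<open>a\<close> and periodicity make exp(-x) (w + w') vanish at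
  \<open>a\<close> and \<open>a + 1\<close>. Its derivative is - exp(-x) f, so a continuous
  \<open>f\<close> of one sign has zero weighted integral over the period.\<close>

lemma inv_helmholtz_vanishing:
  assumes f: "continuous_on UNIV f" "periodic1 f"
    and sign: "(\<forall>x. f x \<ge> 0) \<or> (\<forall>x. f x \<le> 0)"
    and zero: "inv_helmholtz f a = 0" "deriv (inv_helmholtz f) a = 0"
  shows "f x = 0"
proof -
  define w where "w = inv_helmholtz f"
  note w = inv_helmholtz_solves[OF f, folded w_def]
  have "periodic1 (deriv w)" by (rule periodic1_derivative[OF w(1,2)])
  then have ends: "w (a + 1) + deriv w (a + 1) = 0"
    using zero w(1) by (simp add: periodic1_def w_def)
  have "((\<lambda>x. exp (- x) * (w x + deriv w x)) has_real_derivative - (exp (- x) * f x)) (at x)" for x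
    by (auto intro!: derivative_eq_intros w simp: algebra_simps)
  then have "((\<lambda>x. - (exp (- x) * f x)) has_integral
      (exp (- (a + 1)) * (w (a + 1) + deriv w (a + 1)) - exp (- a) * (w a + deriv w a))) {a..a + 1}"
    by (intro fundamental_theorem_of_calculus)
      (auto simp: has_real_derivative_iff_has_vector_derivative [symmetric] has_field_derivative_at_within)
  then have "((\<lambda>x. - (exp (- x) * f x)) has_integral 0) {a..a + 1}"
    using ends zero by (simp add: w_def)
  \<comment> \<open>Both signs are recorded, because vanishing of an integral forces vanishing of
    the integrand in the form stated for nonnegative integrands.\<close>
  then have int: "integral {a..a + 1} (\<lambda>x. - (exp (- x) * f x)) = 0"
    "integral {a..a + 1} (\<lambda>x. exp (- x) * f x) = 0"
    using has_integral_neg by (fastforce dest: integral_unique)+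
  note [continuous_intros] = continuous_on_subset[OF f(1) subset_UNIV]
  have van: "\<forall>y\<in>{a..a + 1}. exp (- y) * f y = 0"
    using sign
  proof
    assume "\<forall>x. f x \<ge> 0"
    then show ?thesis using int(2)
      by (subst (asm) integral_eq_0_iff) (auto intro!: continuous_intros)
  next
    assume "\<forall>x. f x \<le> 0"
    then show ?thesis using int(1)
      by (subst (asm) integral_eq_0_iff) (auto intro!: continuous_intros simp: mult_nonneg_nonpos)
  qed
  have "a + frac (x - a) \<in> {a..a + 1}" using frac_lt_1[of "x - a"] by simp
  then have "f (a + frac (x - a)) = 0" using van by fastforce
  moreover have "a + frac (x - a) = x + of_int (- \<lfloor>x - a\<rfloor>)" by (simp add: frac_def)
  ultimately show ?thesis using periodic1_int[OF f(2), of x "- \<lfloor>x - a\<rfloor>"] by simp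
qed

section \<open>Time derivatives and the flux\<close>

text \<open>For \<open>r \<ge> 0\<close> every weight is at least 1. This makes each Fourier
  coefficient, in particular the mean, continuous in the Sobolev norm.\<close>

lemma fourier_coeff_le_sobolev_norm:
  assumes "r \<ge> 0" "sobolev_term r f summable_on UNIV"
  shows "cmod (fourier_coeff f k) \<le> sobolev_norm r f"
proof -
  have "(1 + (2 * pi * of_int k)\<^sup>2) powr r \<ge> 1"
    using assms(1) by (intro ge_one_powr_ge_zero) auto
  then have "(cmod (fourier_coeff f k))\<^sup>2 \<le> sobolev_term r f k"
    unfolding sobolev_term_def by (simp add: mult_le_cancel_right1)
  also have "\<dots> = (\<Sum>j\<in>{k}. sobolev_term r f j)" by simp
  also have "\<dots> \<le> (\<Sum>\<^sub>\<infinity>j. sobolev_term r f j)"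
    by (rule finite_sum_le_infsum[OF assms(2)]) (auto simp: sobolev_term_nonneg)
  finally show ?thesis unfolding sobolev_norm_def by (rule real_le_rsqrt)
qed

text \<open>The quotient is a linear combination of \<open>u \<tau>\<close>, \<open>u t\<close> and
  \<open>v t\<close>. This stays true at \<open>\<tau> = t\<close>, where division by zero gives
  0.\<close>

lemma sobolev_C1_quotient:
  assumes "sobolev_C1 r I u v" "t \<in> I" "\<tau> \<in> I"
  shows "(\<lambda>x. (u \<tau> x - u t x) / (\<tau> - t) - v t x) \<in> sobolev r"
    and "fourier_coeff (\<lambda>x. (u \<tau> x - u t x) / (\<tau> - t) - v t x) k =
      (fourier_coeff (u \<tau>) k - fourier_coeff (u t) k) / of_real (\<tau> - t) - fourier_coeff (v t) k"
proof -
  let ?a = "1 / (\<tau> - t)"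
  have s: "u \<tau> \<in> sobolev r" "u t \<in> sobolev r" "v t \<in> sobolev r"
    using assms by (auto simp: sobolev_C1_def sobolev_C0_def)
  let ?h = "\<lambda>x. ?a * u \<tau> x + (- ?a) * u t x"
  have h: "?h \<in> sobolev r" using s by (intro sobolev_lincomb)
  have eq: "(\<lambda>x. (u \<tau> x - u t x) / (\<tau> - t) - v t x) = (\<lambda>x. 1 * ?h x + (- 1) * v t x)"
    by (simp add: fun_eq_iff diff_divide_distrib)
  show "(\<lambda>x. (u \<tau> x - u t x) / (\<tau> - t) - v t x) \<in> sobolev r"
    unfolding eq by (rule sobolev_lincomb[OF h s(3)])
  show "fourier_coeff (\<lambda>x. (u \<tau> x - u t x) / (\<tau> - t) - v t x) k =
      (fourier_coeff (u \<tau>) k - fourier_coeff (u t) k) / of_real (\<tau> - t) - fourier_coeff (v t) k"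
    unfolding eq fourier_coeff_lincomb[OF sobolev_set_integrable[OF h] sobolev_set_integrable[OF s(3)]]
      fourier_coeff_lincomb[OF sobolev_set_integrable[OF s(1)] sobolev_set_integrable[OF s(2)]]
    by (simp add: diff_divide_distrib)
qed

lemma eventually_at_within_mem: "\<forall>\<^sub>F \<tau> in at t within I. \<tau> \<in> I"
  by (simp add: eventually_at_filter)

text \<open>The error of the coefficient's difference quotient is a coefficient of the
  function-valued error, whose Sobolev norm tends to 0. Real parts make the map real valued; it is
  used at frequency 0, where the coefficient is real anyway.\<close>

lemma sobolev_C1_fourier_coeff_derivative:
  assumes "sobolev_C1 r I u v" "t \<in> I" "r \<ge> 0"
  shows "((\<lambda>\<tau>. Re (fourier_coeff (u \<tau>) k)) has_real_derivative Re (fourier_coeff (v t) k)) (at t within I)"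
proof -
  let ?g = "\<lambda>\<tau> x. (u \<tau> x - u t x) / (\<tau> - t) - v t x"
  have lim: "((\<lambda>\<tau>. sobolev_norm r (?g \<tau>)) \<longlongrightarrow> 0) (at t within I)"
    using assms by (auto simp: sobolev_C1_def)
  have "((\<lambda>\<tau>. (Re (fourier_coeff (u \<tau>) k) - Re (fourier_coeff (u t) k)) / (\<tau> - t) - Re (fourier_coeff (v t) k))
      \<longlongrightarrow> 0) (at t within I)"
  proof (rule Lim_null_comparison[OF _ lim])
    show "\<forall>\<^sub>F \<tau> in at t within I.
        norm ((Re (fourier_coeff (u \<tau>) k) - Re (fourier_coeff (u t) k)) / (\<tau> - t) - Re (fourier_coeff (v t) k))
        \<le> sobolev_norm r (?g \<tau>)"
      using eventually_at_within_mem
    proof eventually_elim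
      case (elim \<tau>)
      have "(Re (fourier_coeff (u \<tau>) k) - Re (fourier_coeff (u t) k)) / (\<tau> - t) - Re (fourier_coeff (v t) k) =
          Re (fourier_coeff (?g \<tau>) k)"
        by (subst sobolev_C1_quotient(2)[OF assms(1,2) elim]) (simp add: Re_divide_of_real del: of_real_diff)
      moreover have "cmod (fourier_coeff (?g \<tau>) k) \<le> sobolev_norm r (?g \<tau>)"
        using sobolev_C1_quotient(1)[OF assms(1,2) elim] assms(3)
        by (intro fourier_coeff_le_sobolev_norm) (auto simp: sobolev_def)
      ultimately show ?case
        using abs_Re_le_cmod[of "fourier_coeff (?g \<tau>) k"] by simp
    qed
  qed
  then show ?thesis unfolding has_field_derivative_iff by (simp add: LIM_zero_iff)
qed

text \<open>Replacing \<open>v t\<close> by its continuous representative \<open>V\<close> changes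
  no Fourier coefficient, hence no norm, and makes the error of the quotient continuous. The sup
  bound then applies at every \<open>x\<close>.\<close>

lemma sobolev_C1_pointwise_derivative:
  assumes C1: "sobolev_C1 r I u v" "t \<in> I" and r: "r > 1 / 2"
    and cont: "\<And>\<tau>. \<tau> \<in> I \<Longrightarrow> continuous_on UNIV (u \<tau>)"
    and V: "continuous_on UNIV V" "periodic1 V" "AE x in lebesgue. v t x = V x"
  shows "((\<lambda>\<tau>. u \<tau> x) has_real_derivative V x) (at t within I)"
proof -
  let ?g = "\<lambda>\<tau> x. (u \<tau> x - u t x) / (\<tau> - t) - v t x"
  let ?G = "\<lambda>\<tau> x. (u \<tau> x - u t x) / (\<tau> - t) - V x"
  obtain C where C: "\<And>f x. continuous_on UNIV f \<Longrightarrow> periodic1 f \<Longrightarrow> sobolev_term r f summable_on UNIV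
    \<Longrightarrow> \<bar>f x\<bar> \<le> C * sobolev_norm r f"
    using sobolev_sup_bound[OF r] by blast
  have "((\<lambda>\<tau>. sobolev_norm r (?g \<tau>)) \<longlongrightarrow> 0) (at t within I)"
    using C1 by (auto simp: sobolev_C1_def)
  from tendsto_mult_right_zero[OF this]
  have lim: "((\<lambda>\<tau>. C * sobolev_norm r (?g \<tau>)) \<longlongrightarrow> 0) (at t within I)" .
  have "((\<lambda>\<tau>. ?G \<tau> x) \<longlongrightarrow> 0) (at t within I)"
  proof (rule Lim_null_comparison[OF _ lim])
    show "\<forall>\<^sub>F \<tau> in at t within I. norm (?G \<tau> x) \<le> C * sobolev_norm r (?g \<tau>)"
      using eventually_at_within_mem
    proof eventually_elim
      case (elim \<tau>)
      have g: "?g \<tau> \<in> sobolev r" by (rule sobolev_C1_quotient[OF C1 elim])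
      have cG: "continuous_on UNIV (?G \<tau>)"
      \<comment> \<open>At \<open>\<tau> = t\<close> the quotient is 0 by convention, so the
        function is \<open>- V\<close>.\<close>
      proof (cases "\<tau> = t")
        case True
        then show ?thesis using V(1) by (auto intro: continuous_intros)
      next
        case False
        then show ?thesis by (intro continuous_intros cont elim C1 V) auto
      qed
      have "?G \<tau> \<in> borel_measurable borel" using cG by (rule borel_measurable_continuous_onI)
      then have "?G \<tau> \<in> borel_measurable lebesgue" by (intro measurable_completion) simp
      moreover have "AE x in lebesgue. ?G \<tau> x = ?g \<tau> x" using V(3) by eventually_elim simp
      ultimately have "fourier_coeff (?G \<tau>) = fourier_coeff (?g \<tau>)"
        using g by (intro fourier_coeff_cong_AE) (auto simp: sobolev_def)
      then have eq: "sobolev_term r (?G \<tau>) = sobolev_term r (?g \<tau>)"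
        by (simp add: sobolev_term_def fun_eq_iff)
      have "periodic1 (u \<tau>)" "periodic1 (u t)"
        using C1 elim by (auto simp: sobolev_C1_def sobolev_def)
      then have "periodic1 (?G \<tau>)" using V(2) by (simp add: periodic1_def)
      from C[OF cG this, of x] show ?case
        using g by (simp add: eq sobolev_norm_def sobolev_def)
    qed
  qed
  then show ?thesis unfolding has_field_derivative_iff by (simp add: LIM_zero_iff)
qed

section \<open>Sign and zeros of the flux\<close>

lemma flux_factor:
  fixes y z c :: real
  assumes "b = real p * c" "p > 0"
  shows "(3 * real p * c - b) / 2 * y ^ (p - 1) * z\<^sup>2 + b / (real p + 1) * y ^ (p + 1) =
    real p * c * (y ^ (p - 1) * (z\<^sup>2 + y\<^sup>2 / (real p + 1)))"
proof -
  have "y ^ (p + 1) = y ^ (p - 1) * y\<^sup>2"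
    using assms(2) by (simp flip: power_add)
  then show ?thesis by (simp add: assms(1) algebra_simps add_divide_distrib)
qed

text \<open>For \<open>p = 1\<close> both terms are squares with nonnegative coefficients, as 0
  \<le> b \<le> 3c. For b = pc the sign is that of f^(p-1), which is constant when \<open>f\<close>
  has constant sign.\<close>

lemma flux_single_signed:
  fixes f f' :: "real \<Rightarrow> real" and b c :: real and p :: nat
  assumes "c > 0" "p > 0" "(p = 1 \<and> b \<in> {0..3 * c}) \<or> b = real p * c"
    and sign: "(\<forall>x. f x \<ge> 0) \<or> (\<forall>x. f x \<le> 0)"
  defines "F \<equiv> \<lambda>y. (3 * real p * c - b) / 2 * f y ^ (p - 1) * (f' y)\<^sup>2 + b / (real p + 1) * f y ^ (p + 1)"
  shows "(\<forall>x. F x \<ge> 0) \<or> (\<forall>x. F x \<le> 0)"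
  using assms(3)
proof
  assume "p = 1 \<and> b \<in> {0..3 * c}"
  then show ?thesis by (auto simp: F_def)
next
  assume b: "b = real p * c"
  have F: "F x = real p * c * (f x ^ (p - 1) * ((f' x)\<^sup>2 + (f x)\<^sup>2 / (real p + 1)))" for x
    unfolding F_def by (rule flux_factor[OF b assms(2)])
  have "(\<forall>x. f x ^ (p - 1) \<ge> 0) \<or> (\<forall>x. f x ^ (p - 1) \<le> 0)"
    using sign by (cases "even (p - 1)") (auto simp: zero_le_even_power power_le_zero_eq odd_pos)
  moreover have "(f' x)\<^sup>2 + (f x)\<^sup>2 / (real p + 1) \<ge> 0" "real p * c \<ge> 0" for x
    using assms(1) by auto
  ultimately show ?thesis
    unfolding F by (meson mult_nonneg_nonneg mult_nonneg_nonpos mult_nonpos_nonneg)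
qed

text \<open>The zero at \<open>a\<close> serves the case \<open>p = 1\<close>, \<open>b = 0\<close>,
  where the flux only controls \<open>f'\<close> and \<open>f\<close> is merely constant. In the
  other cases the term in f^2 forces \<open>f x = 0\<close> directly.\<close>

lemma flux_zero_imp_zero:
  fixes f f' :: "real \<Rightarrow> real" and b c :: real and p :: nat
  assumes "c > 0" "p > 0" "(p = 1 \<and> b \<in> {0..3 * c}) \<or> b = real p * c"
    and f': "\<And>x. (f has_real_derivative f' x) (at x)"
    and F: "\<And>y. (3 * real p * c - b) / 2 * f y ^ (p - 1) * (f' y)\<^sup>2 + b / (real p + 1) * f y ^ (p + 1) = 0"
    and a: "f a = 0"
  shows "f x = 0"
  using assms(3)
proof
  assume p: "p = 1 \<and> b \<in> {0..3 * c}"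
  show ?thesis
  proof (cases "b = 0")
    case True
    then have "f' y = 0" for y using F[of y] p assms(1) by simp
    then obtain k where "\<And>y. f y = k"
      using has_field_derivative_zero_constant[of UNIV f] f' by auto
    then show ?thesis using a by simp
  next
    case False
    have "(3 * c - b) / 2 * (f' x)\<^sup>2 \<ge> 0" "b / 2 * (f x)\<^sup>2 \<ge> 0" using p by auto
    moreover have "(3 * c - b) / 2 * (f' x)\<^sup>2 + b / 2 * (f x)\<^sup>2 = 0"
      using F[of x] p by (simp add: numeral_2_eq_2)
    ultimately have "b / 2 * (f x)\<^sup>2 = 0" by linarith
    then show ?thesis using False by simp
  qed
next
  assume b: "b = real p * c"
  have "real p * c * (f x ^ (p - 1) * ((f' x)\<^sup>2 + (f x)\<^sup>2 / (real p + 1))) = 0"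
    using F[of x] unfolding flux_factor[OF b assms(2)] .
  then have "f x = 0 \<or> (f' x)\<^sup>2 + (f x)\<^sup>2 / (real p + 1) = 0"
    using assms(1,2) by auto
  moreover have "(f x)\<^sup>2 / (real p + 1) = 0" if "(f' x)\<^sup>2 + (f x)\<^sup>2 / (real p + 1) = 0"
  proof -
    have "(f x)\<^sup>2 / (real p + 1) \<ge> 0" by simp
    then show ?thesis using that zero_le_power2[of "f' x"] by linarith
  qed
  ultimately show ?thesis by (auto simp: add_nonneg_eq_0_iff)
qed

theorem theorem2p4:
  fixes b c s T t0 t1 x0 x1 :: real
    and p :: nat
    and u :: "real \<Rightarrow> real \<Rightarrow> real"
  assumes "b \<ge> 0" and "c > 0" and "p > 0" and "s > 3 / 2" and "T > 0"
    and "nonlocal_solution b c p s T u"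
    and "(\<forall>t\<in>{0..<T}. \<forall>x. u t x \<ge> 0) \<or> (\<forall>t\<in>{0..<T}. \<forall>x. u t x \<le> 0)"
    and "(p = 1 \<and> b \<in> {0..3 * c}) \<or> b = real p * c"
    and "t0 < t1" and "x0 < x1"
    and "{t0<..<t1} \<times> {x0<..<x1} \<subseteq> {0..<T} \<times> {0..<1}"
    and "\<forall>t\<in>{t0<..<t1}. \<forall>x\<in>{x0<..<x1}. u t x = 0"
  shows "\<forall>t\<in>{0..<T}. \<forall>x. u t x = 0"
proof -
  let ?I = "{0..<T}"
  define F where "F t y = (3 * real p * c - b) / 2 * u t y ^ (p - 1) * (deriv (u t) y)\<^sup>2
      + b / (real p + 1) * u t y ^ (p + 1)" for t y
  define w where "w t = inv_helmholtz (F t)" for t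
  \<comment> \<open>The local form of u_t dictated by the equation without its cubic term; it is the
    continuous representative of \<open>v t\<close>.\<close>
  define V where "V t x = - (c * u t x ^ p * deriv (u t) x) - deriv (w t) x" for t x
  obtain v where C1: "sobolev_C1 (s - 1) ?I u v"
    and eq: "\<And>t. t \<in> ?I \<Longrightarrow> AE x in lebesgue.
          v t x + c * u t x ^ p * deriv (u t) x =
          - deriv (inv_helmholtz (\<lambda>y. (3 * real p * c - b) / 2 * u t y ^ (p - 1) * (deriv (u t) y)\<^sup>2
                                      + b / (real p + 1) * u t y ^ (p + 1))) x
          - (real p - 1) * (b - real p * c) / 2
              * inv_helmholtz (\<lambda>y. u t y ^ (p - 2) * (deriv (u t) y) ^ 3) x"
    using assms(6) unfolding nonlocal_solution_def by blast
  have cont: "continuous_on UNIV (u t)" and sob: "u t \<in> sobolev s" if "t \<in> ?I" for t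
    using assms(6) that unfolding nonlocal_solution_def sobolev_C0_def by auto
  have per: "periodic1 (u t)" if "t \<in> ?I" for t
    using sob[OF that] by (simp add: sobolev_def)
  note D = sobolev_C1_embedding[OF assms(4) sob cont]
  have sign: "(\<forall>x. u t x \<ge> 0) \<or> (\<forall>x. u t x \<le> 0)" if "t \<in> ?I" for t
    using assms(7) that by blast
  have F: "continuous_on UNIV (F t)" "periodic1 (F t)" if t: "t \<in> ?I" for t
  proof -
    show "continuous_on UNIV (F t)"
      unfolding F_def by (intro continuous_intros cont D(1) t)
    show "periodic1 (F t)"
      using per[OF t] D(2)[OF t t] by (simp add: periodic1_def F_def)
  qed
  have w: "periodic1 (w t)" "(w t has_real_derivative deriv (w t) x) (at x)"
    "(deriv (w t) has_real_derivative w t x - F t x) (at x)" if "t \<in> ?I" for t x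
    using inv_helmholtz_solves[OF F[OF that]] by (simp_all add: w_def)
  have V_cont: "continuous_on UNIV (V t)" and V_per: "periodic1 (V t)" if t: "t \<in> ?I" for t
  proof -
    have "continuous_on UNIV (deriv (w t))"
      using w(3)[OF t] DERIV_isCont continuous_at_imp_continuous_on by blast
    then show "continuous_on UNIV (V t)"
      unfolding V_def by (intro continuous_intros cont D(1) t)
    have "periodic1 (deriv (w t))"
      by (rule periodic1_derivative[OF w(1,2)]) (rule t)+
    then show "periodic1 (V t)"
      using per[OF t] D(2)[OF t t] by (simp add: periodic1_def V_def)
  qed
  have AE: "AE x in lebesgue. v t x = V t x" if "t \<in> ?I" for t
  proof -
    \<comment> \<open>Each alternative for \<open>b\<close> and \<open>p\<close> kills one of the
      two factors of the cubic coefficient.\<close>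
    have "(real p - 1) * (b - real p * c) = 0" using assms(8) by auto
    then show ?thesis
      using eq[OF that] unfolding F_def[symmetric] w_def[symmetric]
      by (auto simp: V_def elim!: eventually_mono)
  qed
  have mean_v: "fourier_coeff (v t) 0 = 0" if t: "t \<in> ?I" for t
  proof -
    have "V t \<in> borel_measurable borel" using V_cont[OF t] by (rule borel_measurable_continuous_onI)
    then have "V t \<in> borel_measurable lebesgue" by (intro measurable_completion) simp
    moreover have "v t \<in> borel_measurable lebesgue"
      using C1 t by (auto simp: sobolev_C1_def sobolev_C0_def sobolev_def)
    ultimately have "fourier_coeff (v t) = fourier_coeff (V t)"
      using AE[OF t] by (intro fourier_coeff_cong_AE)
    then have "fourier_coeff (v t) 0 = fourier_coeff (V t) 0" by simp
    \<comment> \<open>Divergence form: \<open>V t\<close> is the derivative of the periodic function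
      - c/(p+1) u^(p+1) - w, so its coefficient at frequency 0 carries the factor 0.\<close>
    also have "fourier_coeff (V t) 0 = 2 * pi * of_int 0 * \<i>
        * fourier_coeff (\<lambda>x. - (c / (real p + 1) * u t x ^ (p + 1)) - w t x) 0"
    proof (rule fourier_coeff_deriv[OF _ V_cont[OF t]])
      show "((\<lambda>x. - (c / (real p + 1) * u t x ^ (p + 1)) - w t x) has_real_derivative V t x) (at x)" for x
      proof -
        have "((\<lambda>x. c / (real p + 1) * u t x ^ (p + 1)) has_real_derivative
            c / (real p + 1) * (real (p + 1) * (u t x ^ p * deriv (u t) x))) (at x)"
          using DERIV_cmult[where c = "c / (real p + 1)", OF DERIV_power[OF D(3)[OF t t], of "p + 1" x]] by (simp add: mult_ac)
        moreover have "c / (real p + 1) * (real (p + 1) * y) = c * y" for y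
          by (simp add: divide_simps add_nonneg_eq_0_iff)
        ultimately show ?thesis
          unfolding V_def by (auto intro!: derivative_intros w(2) t simp only: mult.assoc)
      qed
      show "periodic1 (\<lambda>x. - (c / (real p + 1) * u t x ^ (p + 1)) - w t x)"
        using per[OF t] w(1)[OF t] by (simp add: periodic1_def)
    qed
    finally show ?thesis by simp
  qed
  have "((\<lambda>t. Re (fourier_coeff (u t) 0)) has_real_derivative 0) (at t within ?I)" if "t \<in> ?I" for t
    using sobolev_C1_fourier_coeff_derivative[OF C1 that, of 0] mean_v[OF that] assms(4) by simp
  \<comment> \<open>The interval is convex, so vanishing of the derivative within it, one-sided at
    0, makes the mean constant.\<close>
  then obtain m where m: "\<And>t. t \<in> ?I \<Longrightarrow> Re (fourier_coeff (u t) 0) = m"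
    using has_field_derivative_zero_constant[of ?I "\<lambda>t. Re (fourier_coeff (u t) 0)"] by auto
  define t where "t = (t0 + t1) / 2"
  define a where "a = (x0 + x1) / 2"
  have ta: "t \<in> {t0<..<t1}" "a \<in> {x0<..<x1}" using assms(9,10) by (auto simp: t_def a_def)
  then have t: "t \<in> ?I" using assms(11) by blast
  have w'_zero: "deriv (w t) x = 0" if x: "x \<in> {x0<..<x1}" for x
  proof -
    have d: "((\<lambda>\<tau>. u \<tau> x) has_real_derivative V t x) (at t within ?I)"
      using assms(4)
      by (intro sobolev_C1_pointwise_derivative[OF C1 t _ cont V_cont[OF t] V_per[OF t] AE[OF t]]) simp_all
    \<comment> \<open>The derivative within \<open>?I\<close> becomes a two-sided one because
      \<open>t\<close> is interior to the time interval; there \<open>u\<close> is locally zero in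
      time at \<open>x\<close>, so \<open>V t x\<close> must vanish.\<close>
    have "{t0<..<t1} \<subseteq> ?I" using assms(11) x by blast
    then have "((\<lambda>\<tau>. u \<tau> x) has_real_derivative V t x) (at t within {t0<..<t1})"
      using d by (rule DERIV_subset[rotated])
    then have "((\<lambda>\<tau>. u \<tau> x) has_real_derivative V t x) (at t)"
      unfolding at_within_open[OF ta(1) open_greaterThanLessThan] .
    moreover have "((\<lambda>\<tau>. u \<tau> x) has_real_derivative 0) (at t)"
    proof (rule has_field_derivative_transform_within_open[of "\<lambda>_. 0"])
      show "0 = u \<tau> x" if "\<tau> \<in> {t0<..<t1}" for \<tau>
        using assms(12) that x by simp
    qed (use ta assms(12) x in auto)
    ultimately have "V t x = 0" by (rule DERIV_unique)
    moreover have "u t x = 0" using assms(12) ta x by blast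
    ultimately show ?thesis using assms(3) by (simp add: V_def zero_power)
  qed
  have ut_zero: "u t x = 0" for x
  proof -
    \<comment> \<open>For \<open>p = 1\<close> the factor u^(p-1) is 1 even where \<open>u\<close>
      vanishes, so F = 0 at \<open>a\<close> is obtained from u_x = 0.\<close>
    have "deriv (u t) a = 0"
    proof (rule DERIV_imp_deriv, rule has_field_derivative_transform_within_open[of "\<lambda>_. 0" _ _ "{x0<..<x1}"])
      show "0 = u t y" if "y \<in> {x0<..<x1}" for y using assms(12) that ta by metis
    qed (use ta in auto)
    moreover have "u t a = 0" using assms(12) ta by blast
    ultimately have "F t a = 0" by (simp add: F_def)
    \<comment> \<open>Since w_x vanishes on a whole interval around \<open>a\<close>, so does w_xx
      at \<open>a\<close>, and w - w_xx = F gives w = F = 0 there.\<close>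
    moreover have "((deriv (w t)) has_real_derivative 0) (at a)"
      by (rule has_field_derivative_transform_within_open[of "\<lambda>_. 0" _ _ "{x0<..<x1}"])
        (use ta w'_zero in auto)
    then have "w t a - F t a = 0" using w(3)[OF t, of a] DERIV_unique by blast
    ultimately have "w t a = 0" by simp
    have "F t y = 0" for y
    proof (rule inv_helmholtz_vanishing[OF F[OF t]])
      show "(\<forall>x. 0 \<le> F t x) \<or> (\<forall>x. F t x \<le> 0)"
        unfolding F_def by (rule flux_single_signed[OF assms(2,3,8) sign[OF t]])
      show "inv_helmholtz (F t) a = 0" "deriv (inv_helmholtz (F t)) a = 0"
        using \<open>w t a = 0\<close> w'_zero[OF ta(2)] by (simp_all add: w_def)
    qed
    then show ?thesis
      using flux_zero_imp_zero[OF assms(2,3,8) D(3)[OF t t], of a x] \<open>u t a = 0\<close>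
      unfolding F_def by blast
  qed
  have mean: "Re (fourier_coeff (u \<tau>) 0) = integral {0..1} (u \<tau>)" if "\<tau> \<in> ?I" for \<tau>
    unfolding fourier_coeff_continuous[OF cont[OF that]]
    using integral_of_real_continuous[of 0 1 "u \<tau>"] continuous_on_subset[OF cont[OF that]] by simp
  have "u t = (\<lambda>_. 0)" using ut_zero by auto
  \<comment> \<open>The conserved mean is read off at the single time \<open>t\<close> at which
    \<open>u\<close> is known to vanish on the whole circle.\<close>
  then have "m = 0" using m[OF t] mean[OF t] by simp
  show ?thesis
  proof (intro ballI allI)
    fix \<tau> x :: real
    assume \<tau>: "\<tau> \<in> ?I"
    have c01: "continuous_on {0..1} (u \<tau>)" using cont[OF \<tau>] by (rule continuous_on_subset) simp
    have int: "integral {0..1} (u \<tau>) = 0" using m[OF \<tau>] mean[OF \<tau>] \<open>m = 0\<close> by simp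
    \<comment> \<open>A continuous function of constant sign with zero mean vanishes; the
      nonpositive case is reduced to the other by negation.\<close>
    have "\<forall>y\<in>{0..1}. u \<tau> y = 0"
      using sign[OF \<tau>]
    proof
      assume "\<forall>x. u \<tau> x \<ge> 0"
      then show ?thesis using int c01 by (subst (asm) integral_eq_0_iff) auto
    next
      assume nonpos: "\<forall>x. u \<tau> x \<le> 0"
      have "integral {0..1} (\<lambda>y. - u \<tau> y) = 0" using int by simp
      then have "\<forall>y\<in>{0..1}. - u \<tau> y = 0"
        using nonpos c01 by (subst (asm) integral_eq_0_iff) (auto intro: continuous_intros)
      then show ?thesis by simp
    qed
    moreover have "frac x \<in> {0..1}" using frac_lt_1[of x] by simp
    ultimately show "u \<tau> x = 0" using periodic1_frac[OF per[OF \<tau>], of x] by metis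
  qed
qed

end
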